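(* Let $n\ge1$ be an integer, $\alpha\in(0,1)$, $1\le p<\infty$, $1<q<\infty$, and write $p\wedge q=\min\{p,q\}$. (i) If $\frac np+\frac{2\alpha}q-2\alpha>0$, then for every $(t_0,x_0)\in\mathbb R^{1+n}_+$ $$C^{(\alpha)}_{p,q}\big(B^{(\alpha)}_{r_0}(t_0,x_0)\big)\approx r_0^{(p\wedge q)\left(\frac np+\frac{2\alpha}q-2\alpha\right)}\quad\text{as } r_0\to0.$$ (ii) If $\frac np+\frac{2\alpha}q-2\alpha=0$, then for every $(t_0,x_0)\in\mathbb R^{1+n}_+$ $$C^{(\alpha)}_{p,q}\big(B^{(\alpha)}_{r_0}(t_0,x_0)\big)\approx\left(\ln\frac1{r_0}\right)^{(p\wedge q)\left(\frac1q-1\right)}\quad\text{as } r_0\to0.$$ Here $X(r_0)\approx Y(r_0)$ as $r_0\to0$ means that there are constants $c_1,c_2>0$, depending only on $n,\alpha,p,q$, and a threshold $\rho>0$, which may depend on $(t_0,x_0)$, such that $c_1Y(r_0)\le X(r_0)\le c_2Y(r_0)$ for all $0<r_0<\rho$.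
   Context: Notation: $\mathbb R_+=(0,\infty)$ and $\mathbb R^{1+n}_+=\mathbb R_+\times\mathbb R^n$, with points written $(t,x)$. Kernel and operator: $K^{(\alpha)}_t(x)=(2\pi)^{-n/2}\int_{\mathbb R^n}e^{ix\cdot y-t|y|^{2\alpha}}\,dy$ (the kernel of the semigroup $e^{-t(-\Delta)^\alpha}$; for $\alpha\in(0,1)$ it is known that $K^{(\alpha)}_t(x)\approx t\,(t^{1/(2\alpha)}+|x|)^{-(n+2\alpha)}$), and $S_\alpha F(t,x)=\int_0^t\int_{\mathbb R^n}K^{(\alpha)}_{t-s}(x-y)F(s,y)\,dy\,ds$. Mixed norm: $\|F\|_{L^q_tL^p_x(\mathbb R^{1+n}_+)}=\Big(\int_0^\infty\big[\int_{\mathbb R^n}|F(t,x)|^p\,dx\big]^{q/p}dt\Big)^{1/q}$ for $1\le p,q<\infty$. Parabolic ball: $B^{(\alpha)}_r(t_0,x_0)=\{(t,x)\in\mathbb R^{1+n}_+: |t-t_0|<r^{2\alpha},\ |x-x_0|<r\}$. Capacity: for $1\le p,q<\infty$ and compact $K\subset\mathbb R^{1+n}_+$, $$C^{(\alpha)}_{p,q}(K)=\inf\Big\{\|F\|_{L^q_tL^p_x(\mathbb R^{1+n}_+)}^{p\wedge q}:\ F\ge0,\ S_\alpha F\ge1_K\Big\},$$ where $1_K$ is the characteristic function of $K$ and the infimum is over measurable $F$. It is extended to other sets in the standard way: for $G$ open, $C^{(\alpha)}_{p,q}(G)=\sup\{C^{(\alpha)}_{p,q}(K): K\subset G\text{ compact}\}$,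 and for arbitrary $E\subset\mathbb R^{1+n}_+$, $C^{(\alpha)}_{p,q}(E)=\inf\{C^{(\alpha)}_{p,q}(G): G\supset E\text{ open}\}$. *)

theory Defs
  imports "HOL-Analysis.Analysis"
begin

text \<open>Points of space are vectors in \<open>real ^ 'n\<close>, so that \<open>n = CARD('n)\<close>; a space-time point is
  a pair \<open>(t, x)\<close>.\<close>

definition upper_half_space :: "(real \<times> (real ^ 'n::finite)) set"
  where "upper_half_space = {(t, x). 0 < t}"

text \<open>The defining integral is real (by the symmetry \<open>y \<mapsto> -y\<close>, see \<open>frac_kernel_of_real\<close>
  below), so taking the real part only changes the type.\<close>

definition frac_kernel :: "real \<Rightarrow> real \<Rightarrow> real ^ 'n::finite \<Rightarrow> real"
  where "frac_kernel \<alpha> t x =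
    Re (complex_of_real ((2 * pi) powr (- real CARD('n) / 2)) *
      (LINT y|lborel. exp (\<i> * complex_of_real (x \<bullet> y)
         - complex_of_real (t * norm y powr (2 * \<alpha>)))))"

lemma frac_kernel_of_real:
  fixes x :: "real ^ 'n::finite"
  shows "complex_of_real (frac_kernel \<alpha> t x) =
    complex_of_real ((2 * pi) powr (- real CARD('n) / 2)) *
      (LINT y|lborel. exp (\<i> * complex_of_real (x \<bullet> y)
         - complex_of_real (t * norm y powr (2 * \<alpha>))))"
proof -
  let ?f = "\<lambda>y::real ^ 'n. exp (\<i> * complex_of_real (x \<bullet> y)
         - complex_of_real (t * norm y powr (2 * \<alpha>)))"
  let ?I = "LINT y|lborel. ?f y"
  have lb: "lborel = distr lborel borel (\<lambda>y::real ^ 'n. - y)"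
    using lborel_affine[of "-1" "0 :: real ^ 'n"] by (simp add: density_1)
  have m: "?f \<in> borel_measurable borel"
    by measurable
  have "?I = (LINT y|distr lborel borel (\<lambda>y::real ^ 'n. - y). ?f y)"
    using lb by simp
  also have "\<dots> = (LINT y|lborel. ?f (- y))"
    by (rule integral_distr) (use m in auto)
  also have "\<dots> = (LINT y|lborel. cnj (?f y))"
    by (rule Bochner_Integration.integral_cong) (auto simp: exp_cnj)
  also have "\<dots> = cnj ?I" by simp
  finally have "?I \<in> \<real>" by (metis Reals_cnj_iff)
  hence "complex_of_real ((2 * pi) powr (- real CARD('n) / 2)) * ?I \<in> \<real>"
    by (intro Reals_mult) auto
  thus ?thesis unfolding frac_kernel_def by (rule of_real_Re)
qed

text \<open>For \<open>F \<ge> 0\<close> the integrand below is nonnegative, because the kernel is positive when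
  \<open>0 < \<alpha> < 1\<close>; the potential is then well defined with values in \<open>[0, \<infinity>]\<close>.
  The operator is only applied in this situation.\<close>

definition frac_potential ::
    "real \<Rightarrow> (real \<times> (real ^ 'n::finite) \<Rightarrow> real) \<Rightarrow> real \<times> (real ^ 'n) \<Rightarrow> ennreal"
  where "frac_potential \<alpha> F = (\<lambda>(t, x).
    \<integral>\<^sup>+ s \<in> {0<..<t}. (\<integral>\<^sup>+ y. ennreal (frac_kernel \<alpha> (t - s) (x - y) * F (s, y)) \<partial>lborel) \<partial>lborel)"

text \<open>Real powers on \<open>[0, \<infinity>]\<close>, to be used with exponents \<open>a > 0\<close>.\<close>

definition ennreal_power :: "ennreal \<Rightarrow> real \<Rightarrow> ennreal"
  where "ennreal_power u a = (if u = \<infinity> then \<infinity> else ennreal (enn2real u powr a))"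

definition mixed_norm :: "real \<Rightarrow> real \<Rightarrow> (real \<times> (real ^ 'n::finite) \<Rightarrow> real) \<Rightarrow> ennreal"
  where "mixed_norm p q F =
    ennreal_power
      (\<integral>\<^sup>+ t \<in> {0<..}. ennreal_power (\<integral>\<^sup>+ x. ennreal (\<bar>F (t, x)\<bar> powr p) \<partial>lborel) (q / p) \<partial>lborel)
      (1 / q)"

definition parabolic_ball :: "real \<Rightarrow> real \<Rightarrow> real \<Rightarrow> real ^ 'n::finite \<Rightarrow> (real \<times> (real ^ 'n)) set"
  where "parabolic_ball \<alpha> r t0 x0 =
    {(t, x) \<in> upper_half_space. \<bar>t - t0\<bar> < r powr (2 * \<alpha>) \<and> norm (x - x0) < r}"

text \<open>Values of functions outside the upper half space are irrelevant. The infimum over an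
  empty family is \<open>\<infinity>\<close>.\<close>

definition admissible ::
    "real \<Rightarrow> (real \<times> (real ^ 'n::finite)) set \<Rightarrow> (real \<times> (real ^ 'n) \<Rightarrow> real) set"
  where "admissible \<alpha> K =
    {F. F \<in> borel_measurable (restrict_space borel upper_half_space) \<and>
        (\<forall>z \<in> upper_half_space. 0 \<le> F z) \<and>
        (\<forall>z \<in> upper_half_space. indicator K z \<le> frac_potential \<alpha> F z)}"

definition compact_capacity ::
    "real \<Rightarrow> real \<Rightarrow> real \<Rightarrow> (real \<times> (real ^ 'n::finite)) set \<Rightarrow> ennreal"
  where "compact_capacity \<alpha> p q K =
    (INF F \<in> admissible \<alpha> K. ennreal_power (mixed_norm p q F) (min p q))"

definition open_capacity ::
    "real \<Rightarrow> real \<Rightarrow> real \<Rightarrow> (real \<times> (real ^ 'n::finite)) set \<Rightarrow> ennreal"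
  where "open_capacity \<alpha> p q G =
    (SUP K \<in> {K. compact K \<and> K \<subseteq> G}. compact_capacity \<alpha> p q K)"

text \<open>The capacity of an arbitrary subset of the upper half space; on open sets it agrees with
  \<^const>\<open>open_capacity\<close>, see \<open>capacity_open\<close> below.\<close>

definition capacity ::
    "real \<Rightarrow> real \<Rightarrow> real \<Rightarrow> (real \<times> (real ^ 'n::finite)) set \<Rightarrow> ennreal"
  where "capacity \<alpha> p q E =
    (INF G \<in> {G. open G \<and> E \<subseteq> G \<and> G \<subseteq> upper_half_space}. open_capacity \<alpha> p q G)"

lemma capacity_open:
  assumes "open G" "G \<subseteq> upper_half_space"
  shows "capacity \<alpha> p q G = open_capacity \<alpha> p q G"
proof (rule antisym)
  show "capacity \<alpha> p q G \<le> open_capacity \<alpha> p q G"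
    unfolding capacity_def using assms by (intro INF_lower) auto
  show "open_capacity \<alpha> p q G \<le> capacity \<alpha> p q G"
    unfolding capacity_def open_capacity_def
    by (intro INF_greatest SUP_subset_mono) auto
qed

end

theory Submission
  imports Defs "HOL-Probability.Characteristic_Functions"
begin

text \<open>Only three facts about the kernel \<open>K\<close> are needed: \<open>K \<ge> 0\<close>, \<open>\<integral> K\<^sub>t \<le> (2\<pi>)\<^bsup>n/2\<^esup>\<close>, and
  \<open>K\<^sub>t(x) \<approx> t\<^bsup>-n/2\<alpha>\<^esup>\<close> (upper bound everywhere, lower bound for \<open>|x| \<lesssim> t\<^bsup>1/2\<alpha>\<^esup>\<close>). Positivity holds
  because \<open>exp (-t|y|\<^bsup>2\<alpha>\<^esup>)\<close> is a bounded limit of positive mixtures of Gaussians.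

  Lower bound: if \<open>S\<^sub>\<alpha>F \<ge> 1\<close> on the single slice \<open>{t\<^sub>0} \<times> B\<close> with \<open>B\<close> of radius \<open>\<rho>\<close>, integrate \<open>S\<^sub>\<alpha>F(t\<^sub>0, \<cdot>)\<close>
  over \<open>B\<close>. Hoelder in space bounds the contribution of time \<open>s\<close> by
  \<open>\<rho>\<^bsup>n(1-1/p)\<^esup> min(1, \<rho>\<^bsup>2\<alpha>\<^esup>/(t\<^sub>0-s))\<^bsup>n/2\<alpha>p\<^esup>\<close> times the \<open>L\<^sup>p\<close> norm of \<open>F(s, \<cdot>)\<close>, and Hoelder in time reduces
  the claim to \<open>\<integral> min(1, \<rho>\<^bsup>2\<alpha>\<^esup>/\<tau>)\<^bsup>\<beta>\<^esup> d\<tau>\<close> over \<open>(0, t\<^sub>0)\<close> with \<open>\<beta> = nq/(2\<alpha>p(q-1))\<close>. This is \<open>O(\<rho>\<^bsup>2\<alpha>\<^esup>)\<close> for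
  \<open>\<beta> > 1\<close> and \<open>O(\<rho>\<^bsup>2\<alpha>\<^esup> ln (1/\<rho>))\<close> for \<open>\<beta> = 1\<close>, which are precisely the two cases.

  Upper bound: with \<open>\<sigma> = t\<^sub>0 - s\<close>, a multiple of \<open>1/\<sigma>\<close> on the paraboloid
  \<open>|y - x\<^sub>0| \<lesssim> \<sigma>\<^bsup>1/2\<alpha>\<^esup>\<close>, \<open>2r\<^bsup>2\<alpha>\<^esup> \<le> \<sigma> \<le> b\<close>, is admissible; take \<open>b = 4r\<^bsup>2\<alpha>\<^esup>\<close> in the first case and
  \<open>b = t\<^sub>0/2\<close> in the second.\<close>

section \<open>Gaussian integrals\<close>


text \<open>The substitution \<open>y = c * s\<close> with \<open>c = sqrt (2 * \<delta>)\<close>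
  produces the standard normal density and its characteristic function at
  \<open>a / c\<close>.\<close>

lemma has_bochner_integral_iexp_gaussian_real:
  fixes a \<delta> :: real
  assumes "0 < \<delta>"
  shows "has_bochner_integral lborel (\<lambda>s. iexp (a * s) * complex_of_real (exp (- \<delta> * s\<^sup>2)))
    (complex_of_real (sqrt (pi / \<delta>) * exp (- a\<^sup>2 / (4 * \<delta>))))"
proof -
  define c where "c = sqrt (2 * \<delta>)"
  have c: "c > 0" "c\<^sup>2 = 2 * \<delta>" using assms by (auto simp: c_def)
  have eq: "std_normal_density (0 + c * s) *\<^sub>R iexp (a / c * (0 + c * s))
      = complex_of_real (1 / sqrt (2 * pi)) * (iexp (a * s) * complex_of_real (exp (- \<delta> * s\<^sup>2)))" for s
    using c by (simp add: std_normal_density_def scaleR_conv_of_real power_mult_distrib)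
  have "integrable lborel (\<lambda>y. std_normal_density y *\<^sub>R iexp (a / c * y))"
  proof (rule Bochner_Integration.integrable_bound)
    show "integrable lborel std_normal_density" by simp
  qed auto
  from lborel_integrable_real_affine[OF this, of c 0]
  have "integrable lborel (\<lambda>s. complex_of_real (1 / sqrt (2 * pi)) * (iexp (a * s) * complex_of_real (exp (- \<delta> * s\<^sup>2))))"
    unfolding eq using c by simp
  from integrable_mult_right[OF this, of "complex_of_real (sqrt (2 * pi))"]
  have i: "integrable lborel (\<lambda>s. (iexp (a * s) * complex_of_real (exp (- \<delta> * s\<^sup>2))))"
    by (simp add: field_simps)
  have "complex_of_real (exp (- (a / c)\<^sup>2 / 2)) = char std_normal_distribution (a / c)"
    by (simp add: char_std_normal_distribution)
  also have "\<dots> = (LINT y|lborel. std_normal_density y *\<^sub>R iexp (a / c * y))"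
    unfolding char_def by (subst integral_density) auto
  also have "\<dots> = \<bar>c\<bar> *\<^sub>R (LINT s|lborel. std_normal_density (0 + c * s) *\<^sub>R iexp (a / c * (0 + c * s)))"
    by (rule lborel_integral_real_affine) (use c in auto)
  also have "\<dots> = complex_of_real (c / sqrt (2 * pi)) * (LINT s|lborel. (iexp (a * s) * complex_of_real (exp (- \<delta> * s\<^sup>2))))"
    unfolding eq using c by (simp add: scaleR_conv_of_real)
  finally have "complex_of_real (sqrt (2 * pi) / c * exp (- (a / c)\<^sup>2 / 2)) =
      (LINT s|lborel. (iexp (a * s) * complex_of_real (exp (- \<delta> * s\<^sup>2))))"
    using c by (simp add: field_simps)
  moreover have "sqrt (2 * pi) / c = sqrt (pi / \<delta>)"
    using assms by (simp add: c_def real_sqrt_divide real_sqrt_mult)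
  moreover have "- (a / c)\<^sup>2 / 2 = - a\<^sup>2 / (4 * \<delta>)"
    using c by (simp add: power_divide)
  ultimately show ?thesis
    using i by (simp add: has_bochner_integral_iff)
qed

text \<open>\<open>lborel\<close> on a Euclidean space is the image of the product of
  one-dimensional Lebesgue measures over \<open>Basis\<close>, so a product of functions of the
  coordinates integrates factor by factor.\<close>

lemma has_bochner_integral_lborel_prod:
  fixes f :: "'a::euclidean_space \<Rightarrow> real \<Rightarrow> 'b::{real_normed_field, banach, second_countable_topology}"
  assumes "\<And>b. b \<in> Basis \<Longrightarrow> integrable lborel (f b)"
  shows "has_bochner_integral lborel (\<lambda>y::'a. \<Prod>b\<in>Basis. f b (y \<bullet> b)) (\<Prod>b\<in>Basis. integral\<^sup>L lborel (f b))"
proof -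
  interpret product_sigma_finite "\<lambda>_::'a. lborel :: real measure" ..
  have [measurable]: "b \<in> Basis \<Longrightarrow> f b \<in> borel_measurable borel" for b
    using assms[THEN borel_measurable_integrable] by simp
  have "has_bochner_integral (Pi\<^sub>M Basis (\<lambda>_. lborel)) (\<lambda>g. \<Prod>b\<in>Basis. f b (g b)) (\<Prod>b\<in>Basis. integral\<^sup>L lborel (f b))"
    using product_integrable_prod[OF finite_Basis, of f] product_integral_prod[OF finite_Basis, of f] assms
    by (simp add: has_bochner_integral_iff)
  then show ?thesis
    by (subst lborel_eq, subst has_bochner_integral_distr)
       (auto cong: has_bochner_integral_cong)
qed

text \<open>Both \<open>iexp (x \<bullet> y)\<close> and the Gaussian factor over the coordinates,
  so the one-dimensional formula applies to each; the real part is taken at the end.\<close>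

lemma has_bochner_integral_cos_gaussian:
  fixes x :: "'a::euclidean_space"
  assumes "0 < \<delta>"
  shows "has_bochner_integral lborel (\<lambda>y. cos (x \<bullet> y) * exp (- \<delta> * (norm y)\<^sup>2))
    (sqrt (pi / \<delta>) ^ DIM('a) * exp (- (norm x)\<^sup>2 / (4 * \<delta>)))"
proof -
  let ?f = "\<lambda>b s. iexp ((x \<bullet> b) * s) * complex_of_real (exp (- \<delta> * s\<^sup>2))"
  have n: "(norm y)\<^sup>2 = (\<Sum>b\<in>Basis. (y \<bullet> b)\<^sup>2)" for y :: 'a
    unfolding power2_norm_eq_inner by (subst euclidean_inner) (simp add: power2_eq_square)
  have p: "(\<Prod>b\<in>Basis. ?f b (y \<bullet> b)) = iexp (x \<bullet> y) * complex_of_real (exp (- \<delta> * (norm y)\<^sup>2))" for y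
  proof -
    have "(\<Prod>b\<in>Basis. iexp ((x \<bullet> b) * (y \<bullet> b))) = iexp (x \<bullet> y)"
      by (simp add: euclidean_inner[of x y] exp_sum sum_distrib_left)
    moreover have "(\<Prod>b\<in>Basis. exp (- \<delta> * (y \<bullet> b)\<^sup>2)) = exp (- \<delta> * (norm y)\<^sup>2)"
      by (simp add: n exp_sum[symmetric] sum_distrib_left sum_negf)
    ultimately show ?thesis
      unfolding prod.distrib of_real_prod[symmetric] by simp
  qed
  have v: "(\<Prod>b\<in>Basis. integral\<^sup>L lborel (?f b)) =
      complex_of_real (sqrt (pi / \<delta>) ^ DIM('a) * exp (- (norm x)\<^sup>2 / (4 * \<delta>)))"
    using has_bochner_integral_iexp_gaussian_real[OF assms, THEN has_bochner_integral_integral_eq]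
    by (simp add: n prod.distrib exp_sum[symmetric] sum_divide_distrib sum_negf del: of_real_exp flip: of_real_prod)
  have "has_bochner_integral lborel (\<lambda>y. \<Prod>b\<in>Basis. ?f b (y \<bullet> b)) (\<Prod>b\<in>Basis. integral\<^sup>L lborel (?f b))"
    using has_bochner_integral_iexp_gaussian_real[OF assms]
    by (intro has_bochner_integral_lborel_prod) (auto simp: has_bochner_integral_iff)
  from has_bochner_integral_Re[OF this[unfolded p v]]
  show ?thesis
    by (simp add: Re_exp del: of_real_exp)
qed

lemma integrable_gaussian:
  assumes "0 < \<delta>"
  shows "integrable lborel (\<lambda>y::'a::euclidean_space. exp (- \<delta> * (norm y)\<^sup>2))"
    and "(LINT y|lborel. exp (- \<delta> * (norm (y::'a))\<^sup>2)) = sqrt (pi / \<delta>) ^ DIM('a)"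
  using has_bochner_integral_cos_gaussian[OF assms, of "0 :: 'a"] by (auto simp: has_bochner_integral_iff)

section \<open>Integrability of \<open>exp (- t * norm y powr a)\<close>\<close>

text \<open>One term of the exponential series already beats the polynomial: \<open>exp z\<close> is
  at least \<open>z ^ m / fact m\<close> for \<open>z \<ge> 0\<close>, and \<open>m\<close> with
  \<open>a * m \<ge> n + 2\<close> leaves a multiple of \<open>1 / k ^ 2\<close>.\<close>

lemma summable_exp_powr_mult_power:
  fixes a t :: real
  assumes "0 < a" "0 < t"
  shows "summable (\<lambda>k. exp (- t * real k powr a) * (real k + 1) ^ n)"
proof (rule summable_comparison_test')
  define m where "m = nat \<lceil>(real n + 2) / a\<rceil>"
  have "(real n + 2) / a \<le> real m" unfolding m_def by linarith
  then have m: "real n + 2 \<le> a * real m" using assms by (simp add: field_simps)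
  let ?c = "2 ^ n * fact m / t ^ m :: real"
  show "summable (\<lambda>k. ?c * inverse (real k ^ 2))"
    by (intro summable_mult inverse_power_summable) simp
  fix k :: nat assume k: "1 \<le> k"
  then have k0: "0 < real k powr a" by simp
  have "(t * real k powr a) ^ m / fact m = (\<Sum>i\<in>{m}. (t * real k powr a) ^ i / fact i)" by simp
  also have "\<dots> \<le> exp (t * real k powr a)"
    using exp_converges[of "t * real k powr a"] assms
    by (intro sum_le_suminf[of _ "{m}", THEN order_trans]) (auto simp: sums_iff divide_inverse mult.commute)
  finally have "exp (- (t * real k powr a)) \<le> fact m / (t * real k powr a) ^ m"
    using assms k0 by (simp add: exp_minus field_simps)
  also have "(t * real k powr a) ^ m = t ^ m * real k powr (a * real m)"
    using k by (simp add: power_mult_distrib powr_powr flip: powr_realpow)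
  also have "fact m / (t ^ m * real k powr (a * real m)) \<le> fact m / (t ^ m * real k powr (real n + 2))"
    using assms k m by (intro divide_left_mono mult_left_mono powr_mono) auto
  also have "real k powr (real n + 2) = real k ^ n * real k ^ 2"
    using k by (simp add: powr_add powr_realpow)
  finally have e: "exp (- (t * real k powr a)) \<le> fact m / (t ^ m * (real k ^ n * real k ^ 2))" .
  have "(real k + 1) ^ n \<le> (2 * real k) ^ n"
    using k by (intro power_mono) auto
  then have "exp (- (t * real k powr a)) * (real k + 1) ^ n \<le>
      fact m / (t ^ m * (real k ^ n * real k ^ 2)) * (2 * real k) ^ n"
    using e assms by (intro mult_mono) auto
  also have "\<dots> = ?c * inverse (real k ^ 2)"
    using k assms by (simp add: power_mult_distrib field_simps)
  finally show "norm (exp (- t * real k powr a) * (real k + 1) ^ n) \<le> ?c * inverse (real k ^ 2)"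
    by simp
qed

lemma le_suminf_ennreal: "g k \<le> (\<Sum>i. g i)" for g :: "nat \<Rightarrow> ennreal"
  using sum_le_suminf[OF summableI, of "{k}" g] by simp

text \<open>On the shell \<open>k \<le> norm y < k + 1\<close> the function is at most
  \<open>exp (- t * k powr a)\<close>. Enlarging the shell to the ball of radius
  \<open>k + 1\<close> leads to the series of \<open>summable_exp_powr_mult_power\<close>.\<close>

lemma integrable_exp_norm_powr:
  fixes a t :: real
  assumes "0 < a" "0 < t"
  shows "integrable lborel (\<lambda>y::'a::euclidean_space. exp (- t * norm y powr a))"
proof (rule integrableI_bounded)
  define n where "n = DIM('a)"
  define V where "V = unit_ball_vol (real n)"
  define e where "e k = exp (- t * real k powr a)" for k
  define g where "g k y = ennreal (e k) * indicator (ball 0 (real k + 1)) y" for k and y :: 'a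
  have V: "0 \<le> V" by (simp add: V_def)
  have e: "0 \<le> e k" for k by (simp add: e_def)
  have [measurable]: "g k \<in> borel_measurable lborel" for k
  proof -
    have [measurable]: "ball (0::'a) (real k + 1) \<in> sets borel" by simp
    show ?thesis unfolding g_def by measurable
  qed
  have "(\<integral>\<^sup>+(y::'a). ennreal (norm (exp (- t * norm y powr a))) \<partial>lborel) \<le> (\<integral>\<^sup>+y. (\<Sum>k. g k y) \<partial>lborel)"
  proof (rule nn_integral_mono)
    fix y :: 'a
    define k where "k = nat \<lfloor>norm y\<rfloor>"
    have k: "real k \<le> norm y" "norm y < real k + 1" using norm_ge_zero[of y] unfolding k_def by linarith+
    have "ennreal (norm (exp (- t * norm y powr a))) \<le> g k y"
      using k assms by (auto simp: g_def e_def intro!: ennreal_leI powr_mono2)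
    also have "\<dots> \<le> (\<Sum>k. g k y)"
      by (rule le_suminf_ennreal[of "\<lambda>k. g k y"])
    finally show "ennreal (norm (exp (- t * norm y powr a))) \<le> (\<Sum>k. g k y)" .
  qed
  also have "\<dots> = (\<Sum>k. integral\<^sup>N lborel (g k))"
    by (rule nn_integral_suminf) simp
  also have "(\<lambda>k. integral\<^sup>N lborel (g k)) = (\<lambda>k. ennreal (e k * (V * (real k + 1) ^ n)))"
  proof
    fix k
    have "integral\<^sup>N lborel (g k) = ennreal (e k) * emeasure lborel (ball (0::'a) (real k + 1))"
      unfolding g_def by (rule nn_integral_cmult_indicator) simp
    also have "emeasure lborel (ball (0::'a) (real k + 1)) = ennreal (V * (real k + 1) ^ n)"
      unfolding V_def n_def by (rule emeasure_ball) simp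
    also have "ennreal (e k) * \<dots> = ennreal (e k * (V * (real k + 1) ^ n))"
      using e V by (simp add: ennreal_mult')
    finally show "integral\<^sup>N lborel (g k) = ennreal (e k * (V * (real k + 1) ^ n))" .
  qed
  also have "suminf \<dots> < \<infinity>"
  proof -
    have "summable (\<lambda>k. e k * (V * (real k + 1) ^ n))"
      using summable_mult[OF summable_exp_powr_mult_power[OF assms], of V n] by (simp add: mult_ac e_def)
    then have "(\<Sum>k. ennreal (e k * (V * (real k + 1) ^ n))) = ennreal (\<Sum>k. e k * (V * (real k + 1) ^ n))"
      using e V by (intro suminf_ennreal2) auto
    then show ?thesis by simp
  qed
  finally show "(\<integral>\<^sup>+(y::'a). ennreal (norm (exp (- t * norm y powr a))) \<partial>lborel) < \<infinity>" .
qed simp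


section \<open>Positive definiteness against Gaussians\<close>

text \<open>The Gaussian factor makes the Fourier integral meaningful for every bounded \<open>f\<close>, so that the
  class contains the constants and is closed under bounded pointwise limits.\<close>

definition gaussian_pd :: "('a::euclidean_space \<Rightarrow> real) \<Rightarrow> bool"
  where "gaussian_pd f \<longleftrightarrow> f \<in> borel_measurable borel \<and> (\<exists>B. \<forall>y. \<bar>f y\<bar> \<le> B) \<and>
    (\<forall>\<delta>>0. \<forall>x. 0 \<le> (LINT y|lborel. cos (x \<bullet> y) * f y * exp (- \<delta> * (norm y)\<^sup>2)))"

lemma abs_cos_mult_le: "\<bar>b\<bar> \<le> B \<Longrightarrow> \<bar>cos z * b\<bar> \<le> B" for b B z :: real
  using mult_mono[OF abs_cos_le_one[of z], of "\<bar>b\<bar>" B] by (simp add: abs_mult)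

lemma integrable_cos_bounded_gaussian:
  fixes f :: "'a::euclidean_space \<Rightarrow> real"
  assumes [measurable]: "f \<in> borel_measurable borel" and "\<And>y. \<bar>f y\<bar> \<le> B" and "0 < \<delta>"
  shows "integrable lborel (\<lambda>y. cos (x \<bullet> y) * f y * exp (- \<delta> * (norm y)\<^sup>2))"
proof (rule Bochner_Integration.integrable_bound)
  show "integrable lborel (\<lambda>y::'a. B * exp (- \<delta> * (norm y)\<^sup>2))"
    using integrable_gaussian(1)[OF \<open>0 < \<delta>\<close>, where 'a='a] by simp
  have "\<bar>cos (x \<bullet> y) * f y\<bar> \<le> \<bar>B\<bar>" for y
    using abs_cos_mult_le[OF assms(2)[of y], of "x \<bullet> y"] by linarith
  then show "AE y in lborel. norm (cos (x \<bullet> y) * f y * exp (- \<delta> * (norm y)\<^sup>2)) \<le> norm (B * exp (- \<delta> * (norm y)\<^sup>2))"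
    by (auto simp: abs_mult intro!: mult_right_mono)
qed simp

lemma gaussian_pd_const:
  assumes "0 \<le> c"
  shows "gaussian_pd (\<lambda>y::'a::euclidean_space. c)"
proof -
  have "(LINT y|lborel. cos (x \<bullet> y) * c * exp (- \<delta> * (norm y)\<^sup>2))
     = c * (LINT y|lborel. cos (x \<bullet> y) * exp (- \<delta> * (norm y)\<^sup>2))" for x :: 'a and \<delta>
    by (subst integral_mult_right_zero[symmetric], rule Bochner_Integration.integral_cong) auto
  then show ?thesis
    using assms has_bochner_integral_cos_gaussian[where 'a='a, THEN has_bochner_integral_integral_eq]
    by (auto simp: gaussian_pd_def)
qed

lemma gaussian_pd_scale:
  assumes "gaussian_pd f" "0 \<le> c"
  shows "gaussian_pd (\<lambda>y. c * f y)"
  unfolding gaussian_pd_def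
proof (intro conjI allI impI)
  obtain B where "\<And>y. \<bar>f y\<bar> \<le> B" using assms by (auto simp: gaussian_pd_def)
  then show "\<exists>B. \<forall>y. \<bar>c * f y\<bar> \<le> B"
    using \<open>0 \<le> c\<close> by (intro exI[of _ "c * B"]) (auto simp: abs_mult mult_left_mono)
  fix \<delta> :: real and x :: 'a assume "0 < \<delta>"
  have "(LINT y|lborel. cos (x \<bullet> y) * (c * f y) * exp (- \<delta> * (norm y)\<^sup>2))
     = c * (LINT y|lborel. cos (x \<bullet> y) * f y * exp (- \<delta> * (norm y)\<^sup>2))"
    by (subst integral_mult_right_zero[symmetric], rule Bochner_Integration.integral_cong) auto
  then show "0 \<le> (LINT y|lborel. cos (x \<bullet> y) * (c * f y) * exp (- \<delta> * (norm y)\<^sup>2))"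
    using assms \<open>0 < \<delta>\<close> by (auto simp: gaussian_pd_def)
qed (use assms in \<open>auto simp: gaussian_pd_def\<close>)

lemma gaussian_pd_add:
  assumes f: "gaussian_pd f" and g: "gaussian_pd g"
  shows "gaussian_pd (\<lambda>y. f y + g y)"
  unfolding gaussian_pd_def
proof (intro conjI allI impI)
  obtain B where B: "\<And>y. \<bar>f y\<bar> \<le> B" using f by (auto simp: gaussian_pd_def)
  obtain B' where B': "\<And>y. \<bar>g y\<bar> \<le> B'" using g by (auto simp: gaussian_pd_def)
  have [measurable]: "f \<in> borel_measurable borel" "g \<in> borel_measurable borel"
    using f g by (auto simp: gaussian_pd_def)
  then show "(\<lambda>y. f y + g y) \<in> borel_measurable borel" by simp
  show "\<exists>B. \<forall>y. \<bar>f y + g y\<bar> \<le> B"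
    using B B' by (intro exI[of _ "B + B'"]) (meson abs_triangle_ineq add_mono order_trans)
  fix \<delta> :: real and x :: 'a assume "0 < \<delta>"
  have "(LINT y|lborel. cos (x \<bullet> y) * (f y + g y) * exp (- \<delta> * (norm y)\<^sup>2)) =
     (LINT y|lborel. cos (x \<bullet> y) * f y * exp (- \<delta> * (norm y)\<^sup>2)) +
     (LINT y|lborel. cos (x \<bullet> y) * g y * exp (- \<delta> * (norm y)\<^sup>2))"
    unfolding distrib_left distrib_right
    by (rule Bochner_Integration.integral_add)
       (rule integrable_cos_bounded_gaussian[OF _ B \<open>0 < \<delta>\<close>] integrable_cos_bounded_gaussian[OF _ B' \<open>0 < \<delta>\<close>]; simp)+
  then show "0 \<le> (LINT y|lborel. cos (x \<bullet> y) * (f y + g y) * exp (- \<delta> * (norm y)\<^sup>2))"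
    using f g \<open>0 < \<delta>\<close> by (auto simp: gaussian_pd_def)
qed

lemma gaussian_pd_sum:
  assumes "finite I" "\<And>i. i \<in> I \<Longrightarrow> gaussian_pd (f i)"
  shows "gaussian_pd (\<lambda>y. \<Sum>i\<in>I. f i y)"
  using assms by (induction I rule: finite_induct) (auto intro: gaussian_pd_const gaussian_pd_add)

text \<open>This is where the Gaussian factor in \<open>gaussian_pd\<close> pays off: a uniform
  bound \<open>B\<close> gives the integrable majorant
  \<open>B * exp (- \<delta> * (norm y)\<^sup>2)\<close>.\<close>

lemma gaussian_pd_limit:
  fixes f :: "nat \<Rightarrow> 'a::euclidean_space \<Rightarrow> real"
  assumes f: "\<And>k. gaussian_pd (f k)" and B: "\<And>k y. \<bar>f k y\<bar> \<le> B"
    and lim: "\<And>y. (\<lambda>k. f k y) \<longlonglongrightarrow> g y"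
  shows "gaussian_pd g"
  unfolding gaussian_pd_def
proof (intro conjI allI impI)
  have [measurable]: "f k \<in> borel_measurable borel" for k
    using f by (auto simp: gaussian_pd_def)
  show gm[measurable]: "g \<in> borel_measurable borel"
    by (rule borel_measurable_LIMSEQ_real[OF lim]) simp
  have gB: "\<bar>g y\<bar> \<le> B" for y
    by (rule LIMSEQ_le_const2[OF tendsto_rabs[OF lim]]) (use B in auto)
  then show "\<exists>B. \<forall>y. \<bar>g y\<bar> \<le> B" by auto
  fix \<delta> :: real and x :: 'a assume \<delta>: "0 < \<delta>"
  have "(\<lambda>k. LINT y|lborel. cos (x \<bullet> y) * f k y * exp (- \<delta> * (norm y)\<^sup>2))
      \<longlonglongrightarrow> (LINT y|lborel. cos (x \<bullet> y) * g y * exp (- \<delta> * (norm y)\<^sup>2))"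
  proof (rule integral_dominated_convergence[where w="\<lambda>y. B * exp (- \<delta> * (norm y)\<^sup>2)"])
    show "integrable lborel (\<lambda>y::'a. B * exp (- \<delta> * (norm y)\<^sup>2))"
      using integrable_gaussian(1)[OF \<delta>, where 'a='a] by simp
    show "AE y in lborel. (\<lambda>k. cos (x \<bullet> y) * f k y * exp (- \<delta> * (norm y)\<^sup>2)) \<longlonglongrightarrow> cos (x \<bullet> y) * g y * exp (- \<delta> * (norm y)\<^sup>2)"
      by (intro AE_I2 tendsto_intros lim)
    have "\<bar>cos (x \<bullet> y) * f k y\<bar> \<le> B" for y k
      by (intro abs_cos_mult_le B)
    then show "AE y in lborel. norm (cos (x \<bullet> y) * f k y * exp (- \<delta> * (norm y)\<^sup>2)) \<le> B * exp (- \<delta> * (norm y)\<^sup>2)" for k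
      by (auto simp: abs_mult intro!: mult_right_mono)
  qed auto
  then show "0 \<le> (LINT y|lborel. cos (x \<bullet> y) * g y * exp (- \<delta> * (norm y)\<^sup>2))"
    by (rule LIMSEQ_le_const) (use f \<delta> in \<open>auto simp: gaussian_pd_def\<close>)
qed

text \<open>Multiplication by \<open>exp (- u * (norm y)\<^sup>2)\<close> merely replaces
  \<open>\<delta>\<close> by \<open>\<delta> + u\<close> in the defining condition; Fubini turns the
  mixture into an integral of nonnegative numbers weighted by \<open>k\<close>.\<close>

lemma gaussian_pd_mult_mixture:
  fixes f :: "'a::euclidean_space \<Rightarrow> real"
  assumes f: "gaussian_pd f" and k: "integrable lborel k"
    and k0: "\<And>u. 0 \<le> k u" "\<And>u. u \<le> 0 \<Longrightarrow> k u = 0"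
  shows "gaussian_pd (\<lambda>y. f y * (LINT u|lborel. k u * exp (- u * (norm y)\<^sup>2)))"
  unfolding gaussian_pd_def
proof (intro conjI allI impI)
  obtain B where B: "\<And>y. \<bar>f y\<bar> \<le> B" using f by (auto simp: gaussian_pd_def)
  have B0: "0 \<le> B" using B[of 0] by linarith
  have [measurable]: "f \<in> borel_measurable borel" using f by (auto simp: gaussian_pd_def)
  have [measurable]: "k \<in> borel_measurable borel" using k[THEN borel_measurable_integrable] by simp
  show "(\<lambda>y. f y * (LINT u|lborel. k u * exp (- u * (norm y)\<^sup>2))) \<in> borel_measurable borel" by measurable
  have le: "k u * exp (- u * (norm y)\<^sup>2) \<le> k u" for u and y :: 'a
    using k0[of u] by (cases "u \<le> 0") (auto intro!: mult_left_le)
  have int: "integrable lborel (\<lambda>u. k u * exp (- u * (norm y)\<^sup>2))" for y :: 'a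
    by (rule Bochner_Integration.integrable_bound[OF k]) (use le k0 in auto)
  have bd: "(LINT u|lborel. k u * exp (- u * (norm y)\<^sup>2)) \<le> (LINT u|lborel. k u)" for y :: 'a
    by (rule integral_mono[OF int k le])
  have nn: "0 \<le> (LINT u|lborel. k u * exp (- u * (norm y)\<^sup>2))" for y :: 'a
    using k0 by (intro integral_nonneg_AE) auto
  show "\<exists>B. \<forall>y. \<bar>f y * (LINT u|lborel. k u * exp (- u * (norm y)\<^sup>2))\<bar> \<le> B"
    using B B0 bd nn by (intro exI[of _ "B * (LINT u|lborel. k u)"]) (auto simp: abs_mult intro!: mult_mono)
  fix \<delta> :: real and x :: 'a assume \<delta>: "0 < \<delta>"
  let ?g = "\<lambda>y u. cos (x \<bullet> y) * f y * exp (- \<delta> * (norm y)\<^sup>2) * (k u * exp (- u * (norm y)\<^sup>2))"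
  have "integrable (lborel \<Otimes>\<^sub>M lborel) (\<lambda>(y, u). ?g y u)"
  proof (rule Bochner_Integration.integrable_bound)
    show "integrable (lborel \<Otimes>\<^sub>M lborel) (\<lambda>(y::'a, u). B * exp (- \<delta> * (norm y)\<^sup>2) * k u)"
    proof (rule lborel_pair.Fubini_integrable)
      show "AE y::'a in lborel. integrable lborel (\<lambda>u. case (y, u) of (y, u) \<Rightarrow> B * exp (- \<delta> * (norm y)\<^sup>2) * k u)"
        using k by simp
      show "integrable lborel (\<lambda>y::'a. LINT u|lborel. norm (case (y, u) of (y, u) \<Rightarrow> B * exp (- \<delta> * (norm y)\<^sup>2) * k u))"
        using integrable_gaussian(1)[OF \<delta>, where 'a='a] by (simp add: abs_mult)
    qed (simp add: case_prod_beta)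
    have "\<bar>cos (x \<bullet> y) * f y\<bar> \<le> B" for y
      by (intro abs_cos_mult_le B)
    moreover have "\<bar>k u * exp (- u * (norm y)\<^sup>2)\<bar> \<le> k u" for u and y :: 'a
      using le k0 by simp
    ultimately have "\<bar>?g y u\<bar> \<le> B * exp (- \<delta> * (norm y)\<^sup>2) * k u" for y u
      unfolding abs_mult[of "_ * exp (- \<delta> * (norm y)\<^sup>2)"] abs_mult[of _ "exp (- \<delta> * (norm y)\<^sup>2)"]
      using B0 by (intro mult_mono) auto
    then show "AE z in lborel \<Otimes>\<^sub>M lborel. norm (case z of (y, u) \<Rightarrow> ?g y u) \<le> norm (case z of (y, u) \<Rightarrow> B * exp (- \<delta> * (norm y)\<^sup>2) * k u)"
      by (intro AE_I2) (smt (verit) case_prod_beta real_norm_def)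
  qed (simp add: case_prod_beta)
  note F = lborel_pair.Fubini_integral[OF this]
  have "(LINT y|lborel. cos (x \<bullet> y) * (f y * (LINT u|lborel. k u * exp (- u * (norm y)\<^sup>2))) * exp (- \<delta> * (norm y)\<^sup>2))
     = (LINT y|lborel. (LINT u|lborel. ?g y u))"
    by (rule Bochner_Integration.integral_cong[OF refl], subst integral_mult_right_zero) (simp add: mult_ac)
  also have "\<dots> = (LINT u|lborel. (LINT y|lborel. ?g y u))"
    using F by simp
  also have "\<dots> = (LINT u|lborel. k u * (LINT y|lborel. cos (x \<bullet> y) * f y * exp (- (\<delta> + u) * (norm y)\<^sup>2)))"
    by (subst integral_mult_right_zero[symmetric])
       (auto intro!: Bochner_Integration.integral_cong simp: exp_add[symmetric] algebra_simps simp flip: exp_diff)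
  also have "\<dots> \<ge> 0"
  proof (rule integral_nonneg_AE, rule AE_I2)
    fix u
    show "0 \<le> k u * (LINT y|lborel. cos (x \<bullet> y) * f y * exp (- (\<delta> + u) * (norm y)\<^sup>2))"
    \<comment> \<open>For \<open>u \<le> 0\<close> the parameter \<open>\<delta> + u\<close> may
      fail to be positive, but there \<open>k\<close> vanishes.\<close>
    proof (cases "u \<le> 0")
      case False
      then have "0 < \<delta> + u" using \<delta> by simp
      then have "0 \<le> (LINT y|lborel. cos (x \<bullet> y) * f y * exp (- (\<delta> + u) * (norm y)\<^sup>2))"
        using f unfolding gaussian_pd_def by blast
      then show ?thesis using k0 by simp
    qed (simp add: k0)
  qed
  finally show "0 \<le> (LINT y|lborel. cos (x \<bullet> y) * (f y * (LINT u|lborel. k u * exp (- u * (norm y)\<^sup>2))) * exp (- \<delta> * (norm y)\<^sup>2))" .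
qed

text \<open>Repeated multiplication by \<open>h\<close>, starting from the constant 1, gives the
  powers of \<open>h\<close>; the partial sums of the exponential series are bounded by
  \<open>exp m\<close>, so the limit lemma applies.\<close>

lemma gaussian_pd_exp:
  fixes h :: "'a::euclidean_space \<Rightarrow> real"
  assumes mult: "\<And>f. gaussian_pd f \<Longrightarrow> gaussian_pd (\<lambda>y. f y * h y)"
    and h: "\<And>y. 0 \<le> h y" "\<And>y. h y \<le> m"
  shows "gaussian_pd (\<lambda>y. exp (h y))"
proof (rule gaussian_pd_limit)
  have pow: "gaussian_pd (\<lambda>y. h y ^ i)" for i
    by (induction i) (auto intro: gaussian_pd_const mult simp: mult.commute[of "h _"])
  show "gaussian_pd (\<lambda>y. \<Sum>i<N. inverse (fact i) * h y ^ i)" for N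
    by (intro gaussian_pd_sum gaussian_pd_scale pow) auto
  show lim: "(\<lambda>N. \<Sum>i<N. inverse (fact i) * h y ^ i) \<longlonglongrightarrow> exp (h y)" for y
    using exp_converges[of "h y"] by (simp add: sums_def)
  show "\<bar>\<Sum>i<N. inverse (fact i) * h y ^ i\<bar> \<le> exp m" for N y
  proof -
    have "(\<Sum>i<N. inverse (fact i) * h y ^ i) \<le> exp (h y)"
      unfolding exp_def using h summable_exp[of "h y"]
      by (simp, intro sum_le_suminf) auto
    also have "\<dots> \<le> exp m" using h by simp
    finally show ?thesis using h by (simp add: sum_nonneg)
  qed
qed

section \<open>Levy representation of \<open>l powr \<alpha>\<close> and positive definiteness of
  the symbol\<close>

text \<open>Transfers evaluations of gauge integrals, such as those of powers, to Lebesgue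
  integrals; nonnegativity supplies the absolute convergence.\<close>

lemma has_bochner_integral_lborel_nonneg:
  fixes f :: "'a::euclidean_space \<Rightarrow> real"
  assumes f: "(f has_integral I) A" and [measurable]: "A \<in> sets borel" "f \<in> borel_measurable borel"
    and nn: "\<And>x. x \<in> A \<Longrightarrow> 0 \<le> f x"
  shows "has_bochner_integral lborel (\<lambda>x. indicator A x * f x) I"
proof -
  have "((\<lambda>x. indicator A x * f x) has_integral I) UNIV"
  proof -
    have "(\<lambda>x. indicator A x * f x) = (\<lambda>x. if x \<in> A then f x else 0)"
      by (auto simp: indicator_def)
    then show ?thesis using f by (simp add: has_integral_restrict_UNIV)
  qed
  then have "integral\<^sup>N lborel (\<lambda>x. ennreal (indicator A x * f x)) = ennreal I"
    using nn by (intro nn_integral_has_integral_lborel) (auto simp: indicator_def)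
  moreover have "0 \<le> I" using f nn by (rule has_integral_nonneg)
  ultimately show ?thesis
    using nn by (intro has_bochner_integral_nn_integral) (auto simp: indicator_def)
qed

text \<open>The Levy density of the \<open>\<alpha>\<close>-stable subordinator, up to a constant: its Laplace exponent is
  \<open>l powr \<alpha>\<close>.\<close>

definition levy_density :: "real \<Rightarrow> real \<Rightarrow> real"
  where "levy_density \<alpha> u = indicator {0<..} u * u powr (- 1 - \<alpha>)"

lemma levy_density_nonneg [simp]: "0 \<le> levy_density \<alpha> u"
  by (simp add: levy_density_def)

lemma borel_measurable_levy_density [measurable]: "levy_density \<alpha> \<in> borel_measurable borel"
  unfolding levy_density_def[abs_def] by measurable

lemma integrable_levy_density_tail:
  assumes "0 < \<alpha>" "0 < e"
  shows "integrable lborel (\<lambda>u. indicator {e..} u * levy_density \<alpha> u)"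
proof -
  have "has_bochner_integral lborel (\<lambda>u. indicator {e..} u * u powr (- 1 - \<alpha>)) (- (e powr (- 1 - \<alpha> + 1)) / (- 1 - \<alpha> + 1))"
    using assms by (intro has_bochner_integral_lborel_nonneg has_integral_powr_to_inf) auto
  moreover have "(\<lambda>u. indicator {e..} u * levy_density \<alpha> u) = (\<lambda>u. indicator {e..} u * u powr (- 1 - \<alpha>))"
    using assms by (auto simp: levy_density_def indicator_def)
  ultimately show ?thesis by (simp add: has_bochner_integral_iff)
qed

text \<open>Below 1, \<open>1 - exp (- u * l) \<le> u * l\<close> reduces the singularity to
  \<open>u powr (- \<alpha>)\<close>, integrable since \<open>\<alpha> < 1\<close>; beyond 1 that
  factor is at most 1 and the density itself is integrable since
  \<open>\<alpha> > 0\<close>.\<close>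

lemma integrable_levy_density:
  assumes "0 < \<alpha>" "\<alpha> < 1" "0 \<le> l"
  shows "integrable lborel (\<lambda>u. levy_density \<alpha> u * (1 - exp (- u * l)))"
proof (rule Bochner_Integration.integrable_bound)
  have "has_bochner_integral lborel (\<lambda>u. indicator {0..1} u * u powr (- \<alpha>)) (1 powr (- \<alpha> + 1) / (- \<alpha> + 1))"
    using assms by (intro has_bochner_integral_lborel_nonneg has_integral_powr_from_0) auto
  then show "integrable lborel (\<lambda>u. l * (indicator {0..1} u * u powr (- \<alpha>)) + indicator {1..} u * levy_density \<alpha> u)"
    using integrable_levy_density_tail[of \<alpha> 1] assms
    by (intro Bochner_Integration.integrable_add integrable_mult_right) (auto simp: has_bochner_integral_iff)
  have "levy_density \<alpha> u * (1 - exp (- u * l)) \<le> l * (indicator {0..1} u * u powr (- \<alpha>)) + indicator {1..} u * levy_density \<alpha> u"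
    for u
  proof -
    consider "u \<le> 0" | "0 < u" "u < 1" | "1 \<le> u" by linarith
    then show ?thesis
    proof cases
      case 2
      have "1 - exp (- u * l) \<le> u * l" using exp_ge_add_one_self[of "- u * l"] by simp
      then have "u powr (- 1 - \<alpha>) * (1 - exp (- u * l)) \<le> u powr (- 1 - \<alpha>) * (u powr 1 * l)"
        using 2 by (intro mult_left_mono) auto
      also have "\<dots> = l * u powr (- \<alpha>)"
        unfolding mult.assoc[symmetric] powr_add[symmetric] by (simp add: mult.commute)
      finally show ?thesis using 2 by (simp add: levy_density_def)
    next
      case 3
      have "levy_density \<alpha> u * (1 - exp (- u * l)) \<le> levy_density \<alpha> u"
        by (rule mult_left_le) auto
      moreover have "0 \<le> l * (indicator {0..1} u * u powr (- \<alpha>))" using assms by simp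
      ultimately show ?thesis using 3 by simp
    qed (use assms in \<open>simp add: levy_density_def\<close>)
  qed
  moreover have "0 \<le> levy_density \<alpha> u * (1 - exp (- u * l))" for u
    using assms by (cases "u \<le> 0") (auto simp: levy_density_def)
  ultimately show "AE u in lborel. norm (levy_density \<alpha> u * (1 - exp (- u * l)))
      \<le> norm (l * (indicator {0..1} u * u powr (- \<alpha>)) + indicator {1..} u * levy_density \<alpha> u)"
    by (intro AE_I2) (smt (verit) real_norm_def)
qed simp

text \<open>The substitution \<open>u = v / l\<close> pulls out \<open>l powr \<alpha>\<close>, so
  \<open>C\<close> is the integral at \<open>l = 1\<close>.\<close>

lemma powr_eq_levy_integral:
  assumes "0 < \<alpha>" "\<alpha> < 1"
  obtains C where "0 < C" "\<And>l. 0 \<le> l \<Longrightarrow> (LINT u|lborel. levy_density \<alpha> u * (1 - exp (- u * l))) = C * l powr \<alpha>"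
proof
  define C where "C = (LINT u|lborel. levy_density \<alpha> u * (1 - exp (- u * 1)))"
  \<comment> \<open>A lower bound for the integrand on \<open>{1..2}\<close>, giving
    \<open>C > 0\<close>: there \<open>1 - exp (- u)\<close> is smallest at 1 and
    \<open>u powr (- 1 - \<alpha>)\<close> at 2.\<close>
  let ?c = "(1 - exp (-1)) * 2 powr (- 1 - \<alpha>) :: real"
  have "?c * measure lborel {1..2::real} = (LINT u|lborel. indicator {1..2::real} u * ?c)" by simp
  also have "\<dots> \<le> C"
    unfolding C_def
  proof (rule integral_mono)
    show "indicator {1..2} u * ?c \<le> levy_density \<alpha> u * (1 - exp (- u * 1))" for u
    proof (cases "u \<in> {1..2}")
      case True
      then have "2 powr (- 1 - \<alpha>) \<le> u powr (- 1 - \<alpha>)" using assms by (intro powr_mono2') auto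
      then have "(1 - exp (-1)) * 2 powr (- 1 - \<alpha>) \<le> (1 - exp (- u)) * u powr (- 1 - \<alpha>)"
        using True by (intro mult_mono) auto
      then show ?thesis using True by (simp add: levy_density_def mult.commute)
    next
      case False
      then show ?thesis by (cases "u \<le> 0") (auto simp: levy_density_def)
    qed
  qed (use integrable_levy_density[OF assms, of 1] in auto)
  finally have "?c \<le> C" by simp
  moreover have "0 < ?c" by simp
  ultimately show "0 < C" by linarith
  fix l :: real assume l: "0 \<le> l"
  show "(LINT u|lborel. levy_density \<alpha> u * (1 - exp (- u * l))) = C * l powr \<alpha>"
  proof (cases "l = 0")
    case False
    with l have l: "0 < l" by simp
    have "levy_density \<alpha> (0 + (1 / l) * v) * (1 - exp (- (0 + (1 / l) * v) * l)) =
        l powr (1 + \<alpha>) * (levy_density \<alpha> v * (1 - exp (- v * 1)))" for v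
    proof (cases "0 < v")
      case True
      have "(v / l) powr (- 1 - \<alpha>) = l powr (1 + \<alpha>) * v powr (- 1 - \<alpha>)"
        using True l by (simp add: powr_divide powr_minus[of l "1 + \<alpha>", symmetric] divide_powr_uminus add.commute)
      then show ?thesis using True l by (simp add: levy_density_def)
    qed (use l in \<open>simp add: levy_density_def zero_less_divide_iff\<close>)
    note eq = this
    have "(LINT u|lborel. levy_density \<alpha> u * (1 - exp (- u * l))) = \<bar>1 / l\<bar> *\<^sub>R
        (LINT v|lborel. levy_density \<alpha> (0 + (1 / l) * v) * (1 - exp (- (0 + (1 / l) * v) * l)))"
      using l by (intro lborel_integral_real_affine) auto
    also have "\<dots> = \<bar>1 / l\<bar> *\<^sub>R (l powr (1 + \<alpha>) * C)"
      unfolding eq C_def by simp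
    also have "\<dots> = C * l powr \<alpha>"
      using l by (simp add: powr_add)
    finally show ?thesis .
  qed simp
qed

text \<open>With \<open>l = (norm y)\<^sup>2\<close> the Levy identity writes
  \<open>t * norm y powr (2 * \<alpha>)\<close> as the limit of \<open>m j - h j y\<close>, where
  \<open>h j\<close> is a positive mixture of Gaussians of total mass \<open>m j\<close>. As
  \<open>h j y \<le> m j\<close>, the approximants are bounded by 1.\<close>

lemma gaussian_pd_exp_norm_powr:
  assumes \<alpha>: "0 < \<alpha>" "\<alpha> < 1" and t: "0 < t"
  shows "gaussian_pd (\<lambda>y::'a::euclidean_space. exp (- t * norm y powr (2 * \<alpha>)))"
proof -
  obtain C where C: "0 < C" "\<And>l. 0 \<le> l \<Longrightarrow> (LINT u|lborel. levy_density \<alpha> u * (1 - exp (- u * l))) = C * l powr \<alpha>"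
    using powr_eq_levy_integral[OF \<alpha>] by blast
  define I where "I j u = (indicator {1 / real (Suc j)..} u :: real)" for j u
  have [measurable]: "I j \<in> borel_measurable borel" for j unfolding I_def by measurable
  define k where "k j u = t / C * (I j u * levy_density \<alpha> u)" for j u
  have k: "integrable lborel (k j)" "0 \<le> k j u" "u \<le> 0 \<Longrightarrow> k j u = 0" for j u
    unfolding k_def I_def using integrable_levy_density_tail[OF \<alpha>(1), of "1 / real (Suc j)"] C(1) t
    by (auto simp: levy_density_def indicator_def)
  have ke: "integrable lborel (\<lambda>u. k j u * exp (- u * (norm y)\<^sup>2))" "k j u * exp (- u * (norm y)\<^sup>2) \<le> k j u" for j u and y :: 'a
  proof -
    show le: "k j u * exp (- u * (norm y)\<^sup>2) \<le> k j u" for u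
      using k(2)[of j u] k(3)[of u j] by (cases "u \<le> 0") (auto intro!: mult_left_le)
    show "integrable lborel (\<lambda>u. k j u * exp (- u * (norm y)\<^sup>2))"
    proof (rule Bochner_Integration.integrable_bound[OF k(1)[of j]])
      show "(\<lambda>u. k j u * exp (- u * (norm y)\<^sup>2)) \<in> borel_measurable lborel"
        unfolding k_def by measurable
    qed (use le k(2) in auto)
  qed
  define h where "h j y = (LINT u|lborel. k j u * exp (- u * (norm y)\<^sup>2))" for j and y :: 'a
  define m where "m j = (LINT u|lborel. k j u)" for j
  have h: "0 \<le> h j y" "h j y \<le> m j" for j y
    unfolding h_def m_def using k ke by (auto intro!: integral_nonneg_AE integral_mono)
  \<comment> \<open>Cutting the density off near \<open>0\<close> gives it finite mass \<open>m j\<close>; then \<open>exp (h j - m j)\<close> is the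
    characteristic function of a compound Poisson mixture of Gaussians.\<close>
  have "gaussian_pd (\<lambda>y. exp (h j y))" for j
    unfolding h_def
    by (intro gaussian_pd_exp[OF _ h[unfolded h_def]] gaussian_pd_mult_mixture k)
  then have pd: "gaussian_pd (\<lambda>y. exp (- m j) * exp (h j y))" for j
    by (rule gaussian_pd_scale) simp
  show ?thesis
  proof (rule gaussian_pd_limit[OF pd])
    show "\<bar>exp (- m j) * exp (h j y)\<bar> \<le> 1" for j y
      using h[of j y] by (simp add: exp_add[symmetric])
    fix y :: 'a
    let ?w = "\<lambda>u. levy_density \<alpha> u * (1 - exp (- u * (norm y)\<^sup>2))"
    have w: "integrable lborel ?w" by (rule integrable_levy_density) (use \<alpha> in auto)
    have "(\<lambda>j. LINT u|lborel. I j u * ?w u) \<longlonglongrightarrow> (LINT u|lborel. ?w u)"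
    proof (rule integral_dominated_convergence[OF _ _ w[THEN integrable_norm]])
      show "AE u in lborel. (\<lambda>j. I j u * ?w u) \<longlonglongrightarrow> ?w u"
      proof (rule AE_I2)
        fix u :: real
        show "(\<lambda>j. I j u * ?w u) \<longlonglongrightarrow> ?w u"
        proof (cases "0 < u")
          case True
          have "eventually (\<lambda>j. 1 / real (Suc j) < u) sequentially"
            using LIMSEQ_inverse_real_of_nat True by (intro order_tendstoD) (auto simp: inverse_eq_divide)
          then have "eventually (\<lambda>j. ?w u = I j u * ?w u) sequentially"
            by eventually_elim (simp add: I_def)
          then show ?thesis by (rule Lim_transform_eventually[OF tendsto_const])
        qed (simp add: levy_density_def)
      qed
      show "AE u in lborel. norm (I j u * ?w u) \<le> norm (?w u)" for j
        by (simp add: I_def indicator_def)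
    qed simp_all
    then have "(\<lambda>j. t / C * (LINT u|lborel. I j u * ?w u)) \<longlonglongrightarrow> t / C * (C * ((norm y)\<^sup>2) powr \<alpha>)"
      unfolding C(2)[OF zero_le_power2] by (rule tendsto_mult_left)
    also have "(\<lambda>j. t / C * (LINT u|lborel. I j u * ?w u)) = (\<lambda>j. m j - h j y)"
    proof
      fix j
      have "m j - h j y = (LINT u|lborel. k j u - k j u * exp (- u * (norm y)\<^sup>2))"
        unfolding m_def h_def using k ke by (intro Bochner_Integration.integral_diff[symmetric])
      also have "\<dots> = (LINT u|lborel. t / C * (I j u * ?w u))"
        by (rule Bochner_Integration.integral_cong) (auto simp: k_def algebra_simps)
      finally show "t / C * (LINT u|lborel. I j u * ?w u) = m j - h j y" by simp
    qed
    also have "t / C * (C * ((norm y)\<^sup>2) powr \<alpha>) = t * norm y powr (2 * \<alpha>)"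
      using C(1) by (cases "y = 0") (auto simp: powr_powr simp flip: powr_numeral)
    finally have "(\<lambda>j. exp (- (m j - h j y))) \<longlonglongrightarrow> exp (- (t * norm y powr (2 * \<alpha>)))"
      by (intro tendsto_intros)
    then show "(\<lambda>j. exp (- m j) * exp (h j y)) \<longlonglongrightarrow> exp (- t * norm y powr (2 * \<alpha>))"
      by (simp add: exp_add[symmetric])
  qed
qed


section \<open>Kernel bounds\<close>

lemma lborel_integral_affine:
  fixes f :: "'a::euclidean_space \<Rightarrow> 'b::{banach, second_countable_topology}"
  assumes [measurable]: "f \<in> borel_measurable borel" and "c \<noteq> 0"
  shows "(LINT y|lborel. f y) = \<bar>c\<bar> ^ DIM('a) *\<^sub>R (LINT y|lborel. f (a + c *\<^sub>R y))"
  by (subst lborel_affine[OF \<open>c \<noteq> 0\<close>, of a]) (simp add: integral_density integral_distr)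

text \<open>From here on the kernel is handled as a cosine transform; integrability of the symbol
  allows the real part to be taken under the integral.\<close>

lemma frac_kernel_eq:
  fixes x :: "real ^ 'n::finite"
  assumes "0 < \<alpha>" "0 < t"
  shows "frac_kernel \<alpha> t x = (2 * pi) powr (- real CARD('n) / 2) *
    (LINT y|lborel. cos (x \<bullet> y) * exp (- t * norm y powr (2 * \<alpha>)))"
proof -
  let ?f = "\<lambda>y::real ^ 'n. exp (\<i> * complex_of_real (x \<bullet> y) - complex_of_real (t * norm y powr (2 * \<alpha>)))"
  have i: "integrable lborel ?f"
  proof (rule Bochner_Integration.integrable_bound)
    show "integrable lborel (\<lambda>y::real ^ 'n. exp (- t * norm y powr (2 * \<alpha>)))"
      using assms by (intro integrable_exp_norm_powr) auto
  qed auto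
  have "Re (LINT y|lborel. ?f y) = (LINT y|lborel. Re (?f y))"
    by (rule integral_Re[symmetric, OF i])
  also have "\<dots> = (LINT y|lborel. cos (x \<bullet> y) * exp (- t * norm y powr (2 * \<alpha>)))"
    by (rule Bochner_Integration.integral_cong) (auto simp: Re_exp)
  finally show ?thesis
    by (simp add: frac_kernel_def)
qed

lemma integrable_cos_exp_norm_powr:
  fixes x :: "'a::euclidean_space"
  assumes "0 < a" "0 < t"
  shows "integrable lborel (\<lambda>y. cos (x \<bullet> y) * exp (- t * norm y powr a))"
proof (rule Bochner_Integration.integrable_bound[OF integrable_exp_norm_powr[OF assms]])
qed (auto simp: abs_mult)

lemma borel_measurable_frac_kernel [measurable]:
  assumes [measurable]: "f \<in> borel_measurable M" "g \<in> borel_measurable M"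
  shows "(\<lambda>z. frac_kernel \<alpha> (f z) (g z)) \<in> borel_measurable M"
  unfolding frac_kernel_def by measurable

text \<open>\<open>gaussian_pd\<close> gives nonnegativity in the presence of a factor
  \<open>exp (- \<delta> * (norm y)\<^sup>2)\<close>; dominated convergence along
  \<open>\<delta> = 1 / (j + 1)\<close> removes it.\<close>

lemma frac_kernel_nonneg:
  fixes x :: "real ^ 'n::finite"
  assumes \<alpha>: "0 < \<alpha>" "\<alpha> < 1" and t: "0 < t"
  shows "0 \<le> frac_kernel \<alpha> t x"
proof -
  let ?f = "\<lambda>y::real ^ 'n. cos (x \<bullet> y) * exp (- t * norm y powr (2 * \<alpha>))"
  let ?d = "\<lambda>j. inverse (real (Suc j))"
  have "(\<lambda>j. LINT y|lborel. ?f y * exp (- ?d j * (norm y)\<^sup>2)) \<longlonglongrightarrow> (LINT y|lborel. ?f y)"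
  proof (rule integral_dominated_convergence)
    show "integrable lborel (\<lambda>y. norm (?f y))"
      using integrable_cos_exp_norm_powr[of "2 * \<alpha>" t x] \<alpha> t by simp
    have "(\<lambda>j. ?f y * exp (- ?d j * (norm y)\<^sup>2)) \<longlonglongrightarrow> ?f y * exp (- 0 * (norm y)\<^sup>2)" for y
      by (intro tendsto_intros LIMSEQ_inverse_real_of_nat)
    then show "AE y in lborel. (\<lambda>j. ?f y * exp (- ?d j * (norm y)\<^sup>2)) \<longlonglongrightarrow> ?f y" by simp
    show "AE y in lborel. norm (?f y * exp (- ?d j * (norm y)\<^sup>2)) \<le> norm (?f y)" for j
      by (simp add: abs_mult mult_left_le)
  qed auto
  moreover have "0 \<le> (LINT y|lborel. ?f y * exp (- ?d j * (norm y)\<^sup>2))" for j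
    using gaussian_pd_exp_norm_powr[OF \<alpha> t, where 'a="real ^ 'n"] by (simp add: gaussian_pd_def)
  ultimately have "0 \<le> (LINT y|lborel. ?f y)"
    by (intro LIMSEQ_le_const) auto
  then show ?thesis using frac_kernel_eq[of \<alpha> t x] \<alpha> t by simp
qed

text \<open>Dilating \<open>y\<close> by \<open>c = t powr (- 1 / (2 * \<alpha>))\<close>, for which
  \<open>t * c powr (2 * \<alpha>) = 1\<close>, reduces every time to time 1.\<close>

lemma frac_kernel_scale:
  fixes x :: "real ^ 'n::finite"
  assumes "0 < \<alpha>" "0 < t"
  shows "frac_kernel \<alpha> t x = t powr (- real CARD('n) / (2 * \<alpha>)) * frac_kernel \<alpha> 1 (t powr (- 1 / (2 * \<alpha>)) *\<^sub>R x)"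
proof -
  define c where "c = t powr (- 1 / (2 * \<alpha>))"
  have c: "0 < c" using assms by (simp add: c_def)
  have c1: "t * c powr (2 * \<alpha>) = 1"
    unfolding c_def powr_powr using assms by (simp add: powr_minus)
  have c2: "c ^ CARD('n) = t powr (- real CARD('n) / (2 * \<alpha>))"
    using assms c by (simp add: c_def powr_powr flip: powr_realpow)
  have e: "cos (x \<bullet> (0 + c *\<^sub>R y)) * exp (- t * norm (0 + c *\<^sub>R y) powr (2 * \<alpha>))
      = cos ((c *\<^sub>R x) \<bullet> y) * exp (- 1 * norm y powr (2 * \<alpha>))" for y
  proof -
    have "t * (c * norm y) powr (2 * \<alpha>) = norm y powr (2 * \<alpha>)"
      using c c1 by (simp add: powr_mult flip: mult.assoc)
    then show ?thesis using c by simp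
  qed
  have "(LINT y|lborel. cos (x \<bullet> y) * exp (- t * norm y powr (2 * \<alpha>)))
     = \<bar>c\<bar> ^ DIM(real ^ 'n) *\<^sub>R (LINT y|lborel. cos (x \<bullet> (0 + c *\<^sub>R y)) * exp (- t * norm (0 + c *\<^sub>R y) powr (2 * \<alpha>)))"
    by (rule lborel_integral_affine) (use c in auto)
  also have "\<dots> = t powr (- real CARD('n) / (2 * \<alpha>)) * (LINT y|lborel. cos ((c *\<^sub>R x) \<bullet> y) * exp (- 1 * norm y powr (2 * \<alpha>)))"
    unfolding e using c c2 by simp
  finally show ?thesis
    using assms by (simp add: frac_kernel_eq c_def)
qed

lemma frac_kernel_le:
  fixes x :: "real ^ 'n::finite"
  assumes "0 < \<alpha>" "0 < t"
  shows "frac_kernel \<alpha> t x \<le> frac_kernel \<alpha> 1 (0 :: real ^ 'n) * t powr (- real CARD('n) / (2 * \<alpha>))"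
proof -
  have "frac_kernel \<alpha> 1 z \<le> frac_kernel \<alpha> 1 (0 :: real ^ 'n)" for z :: "real ^ 'n"
  proof -
    have "(LINT y|lborel. cos (z \<bullet> y) * exp (- 1 * norm y powr (2 * \<alpha>)))
        \<le> (LINT y|lborel. cos (0 \<bullet> (y :: real ^ 'n)) * exp (- 1 * norm y powr (2 * \<alpha>)))"
      using assms by (intro integral_mono integrable_cos_exp_norm_powr) auto
    then show ?thesis using assms by (simp add: frac_kernel_eq)
  qed
  then show ?thesis
    by (subst frac_kernel_scale[OF assms], subst mult.commute) (auto intro!: mult_right_mono)
qed

lemma frac_kernel_zero_pos:
  assumes "0 < \<alpha>"
  shows "0 < frac_kernel \<alpha> 1 (0 :: real ^ 'n::finite)"
proof -
  let ?f = "\<lambda>y::real ^ 'n. exp (- 1 * norm y powr (2 * \<alpha>))"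
  have i: "integrable lborel ?f" using assms by (intro integrable_exp_norm_powr) auto
  have "integral\<^sup>L lborel ?f \<noteq> 0"
  proof
    assume "integral\<^sup>L lborel ?f = 0"
    then have "AE y in lborel. ?f y = 0"
      using integral_nonneg_eq_0_iff_AE[OF i] by simp
    then have "emeasure lborel (UNIV :: (real ^ 'n) set) = 0"
      by (simp add: eventually_False ae_filter_eq_bot_iff)
    then show False by (simp add: emeasure_lborel_UNIV)
  qed
  moreover have "0 \<le> integral\<^sup>L lborel ?f"
    by (rule Bochner_Integration.integral_nonneg) simp
  ultimately have "0 < integral\<^sup>L lborel ?f"
    by linarith
  then show ?thesis using assms by (simp add: frac_kernel_eq)
qed

lemma isCont_frac_kernel_zero:
  assumes "0 < \<alpha>"
  shows "isCont (frac_kernel \<alpha> 1) (0 :: real ^ 'n::finite)"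
  unfolding continuous_at_sequentially comp_def
proof (intro allI impI)
  fix X :: "nat \<Rightarrow> real ^ 'n" assume X: "X \<longlonglongrightarrow> 0"
  have "(\<lambda>j. LINT y|lborel. cos (X j \<bullet> y) * exp (- 1 * norm y powr (2 * \<alpha>)))
      \<longlonglongrightarrow> (LINT y|lborel. cos (0 \<bullet> (y :: real ^ 'n)) * exp (- 1 * norm y powr (2 * \<alpha>)))"
  proof (rule integral_dominated_convergence)
    show "integrable lborel (\<lambda>y::real ^ 'n. exp (- 1 * norm y powr (2 * \<alpha>)))"
      using assms by (intro integrable_exp_norm_powr) auto
    show "AE y in lborel. (\<lambda>j. cos (X j \<bullet> y) * exp (- 1 * norm y powr (2 * \<alpha>))) \<longlonglongrightarrow> cos (0 \<bullet> y) * exp (- 1 * norm y powr (2 * \<alpha>))"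
      by (intro AE_I2 tendsto_intros X)
  qed (auto simp: abs_mult)
  then show "(\<lambda>j. frac_kernel \<alpha> 1 (X j)) \<longlonglongrightarrow> frac_kernel \<alpha> 1 (0 :: real ^ 'n)"
    unfolding frac_kernel_eq[OF assms zero_less_one] by (rule tendsto_mult_left)
qed

text \<open>Continuity at 0 keeps the time-1 kernel above half its central value on a small ball;
  scaling carries this to all times.\<close>

lemma frac_kernel_ge:
  assumes "0 < \<alpha>"
  obtains c d where "0 < c" "0 < d"
    "\<And>t x. 0 < t \<Longrightarrow> norm (x :: real ^ 'n::finite) \<le> d * t powr (1 / (2 * \<alpha>)) \<Longrightarrow>
      c * t powr (- real CARD('n) / (2 * \<alpha>)) \<le> frac_kernel \<alpha> t x"
proof -
  define c where "c = frac_kernel \<alpha> 1 (0 :: real ^ 'n) / 2"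
  have c: "0 < c" using frac_kernel_zero_pos[OF assms] by (simp add: c_def)
  from isCont_frac_kernel_zero[OF assms, where 'n='n, unfolded continuous_at_eps_delta, rule_format, OF c]
  obtain d where "0 < d \<and> (\<forall>x::real ^ 'n. dist x 0 < d \<longrightarrow> dist (frac_kernel \<alpha> 1 x) (frac_kernel \<alpha> 1 (0 :: real ^ 'n)) < c)"
    by blast
  then have d: "0 < d" "\<And>x::real ^ 'n. dist x 0 < d \<Longrightarrow> dist (frac_kernel \<alpha> 1 x) (frac_kernel \<alpha> 1 (0 :: real ^ 'n)) < c"
    by simp_all
  show ?thesis
  \<comment> \<open>Continuity provides an open ball of radius \<open>d\<close>; the closed ball of
    half the radius fits inside.\<close>
  proof (rule that[of c "d / 2"])
    fix t :: real and x :: "real ^ 'n" assume t: "0 < t" and x: "norm x \<le> d / 2 * t powr (1 / (2 * \<alpha>))"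
    have "norm (t powr (- 1 / (2 * \<alpha>)) *\<^sub>R x) = t powr (- 1 / (2 * \<alpha>)) * norm x" by simp
    also have "\<dots> \<le> t powr (- 1 / (2 * \<alpha>)) * (d / 2 * t powr (1 / (2 * \<alpha>)))"
      using x by (rule mult_left_mono) simp
    also have "\<dots> = d / 2 * t powr (- 1 / (2 * \<alpha>) + 1 / (2 * \<alpha>))"
      unfolding powr_add by (rule mult.left_commute)
    also have "\<dots> = d / 2" using t by simp
    finally have "norm (t powr (- 1 / (2 * \<alpha>)) *\<^sub>R x) \<le> d / 2" .
    then have "dist (t powr (- 1 / (2 * \<alpha>)) *\<^sub>R x) 0 < d"
      using d(1) unfolding dist_norm diff_0_right by linarith
    then have "dist (frac_kernel \<alpha> 1 (t powr (- 1 / (2 * \<alpha>)) *\<^sub>R x)) (frac_kernel \<alpha> 1 (0 :: real ^ 'n)) < c"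
      by (rule d(2))
    then have "c \<le> frac_kernel \<alpha> 1 (t powr (- 1 / (2 * \<alpha>)) *\<^sub>R x)"
      unfolding dist_real_def c_def by linarith
    then show "c * t powr (- real CARD('n) / (2 * \<alpha>)) \<le> frac_kernel \<alpha> t x"
      by (subst frac_kernel_scale[OF assms t], subst mult.commute) (auto intro!: mult_left_mono)
  qed (use c d in auto)
qed

text \<open>Testing the nonnegative kernel against \<open>exp (- \<epsilon> |x|\<^sup>2)\<close> and exchanging the integrals leaves a
  Gaussian in \<open>y\<close> whose mass does not depend on \<open>\<epsilon>\<close>.\<close>

lemma nn_integral_frac_kernel_le:
  assumes \<alpha>: "0 < \<alpha>" "\<alpha> < 1" and t: "0 < t"
  shows "(\<integral>\<^sup>+ x. ennreal (frac_kernel \<alpha> t (x :: real ^ 'n::finite)) \<partial>lborel) \<le> ennreal ((2 * pi) powr (real CARD('n) / 2))"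
proof -
  define n where "n = CARD('n)"
  let ?M = "(2 * pi) powr (real n / 2)"
  let ?e = "\<lambda>y::real ^ 'n. exp (- t * norm y powr (2 * \<alpha>))"
  have bound: "(\<integral>\<^sup>+ x. ennreal (frac_kernel \<alpha> t (x :: real ^ 'n) * exp (- \<epsilon> * (norm x)\<^sup>2)) \<partial>lborel) \<le> ennreal ?M"
    if \<epsilon>: "0 < \<epsilon>" for \<epsilon>
  proof -
    let ?g = "\<lambda>(x::real ^ 'n) y. (2 * pi) powr (- real n / 2) * (cos (x \<bullet> y) * ?e y * exp (- \<epsilon> * (norm x)\<^sup>2))"
    have int: "integrable (lborel \<Otimes>\<^sub>M lborel) (\<lambda>(x, y). ?g x y)"
    proof (rule Bochner_Integration.integrable_bound)
      show "integrable (lborel \<Otimes>\<^sub>M lborel) (\<lambda>(x::real ^ 'n, y). (2 * pi) powr (- real n / 2) * (?e y * exp (- \<epsilon> * (norm x)\<^sup>2)))"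
      proof (rule lborel_pair.Fubini_integrable)
        show "AE x::real ^ 'n in lborel. integrable lborel (\<lambda>y. case (x, y) of (x, y) \<Rightarrow> (2 * pi) powr (- real n / 2) * (?e y * exp (- \<epsilon> * (norm x)\<^sup>2)))"
          using integrable_exp_norm_powr[of "2 * \<alpha>" t, where 'a="real ^ 'n"] \<alpha> t by simp
        show "integrable lborel (\<lambda>x::real ^ 'n. LINT y|lborel. norm (case (x, y) of (x, y) \<Rightarrow> (2 * pi) powr (- real n / 2) * (?e y * exp (- \<epsilon> * (norm x)\<^sup>2))))"
          using integrable_gaussian(1)[OF \<epsilon>, where 'a="real ^ 'n"] by (simp add: abs_mult)
      qed (simp add: case_prod_beta)
      show "AE z in lborel \<Otimes>\<^sub>M lborel. norm (case z of (x, y) \<Rightarrow> ?g x y)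
          \<le> norm (case z of (x, y) \<Rightarrow> (2 * pi) powr (- real n / 2) * (?e y * exp (- \<epsilon> * (norm x)\<^sup>2)))"
        by (auto simp: abs_mult intro!: AE_I2 mult_left_mono mult_right_mono mult_left_le_one_le)
    qed (simp add: case_prod_beta)
    have inner: "(LINT y|lborel. ?g x y) = frac_kernel \<alpha> t x * exp (- \<epsilon> * (norm x)\<^sup>2)" for x
    proof -
      have "(LINT y|lborel. ?g x y) = (LINT y|lborel. (2 * pi) powr (- real n / 2) * exp (- \<epsilon> * (norm x)\<^sup>2) * (cos (x \<bullet> y) * ?e y))"
        by (rule Bochner_Integration.integral_cong) (auto simp: mult_ac)
      then show ?thesis using \<alpha> t by (simp add: frac_kernel_eq n_def)
    qed
    have ix: "integrable lborel (\<lambda>x::real ^ 'n. frac_kernel \<alpha> t x * exp (- \<epsilon> * (norm x)\<^sup>2))"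
      using lborel_pair.integrable_fst[OF int] by (simp only: inner)
    have "(\<integral>\<^sup>+ x. ennreal (frac_kernel \<alpha> t (x :: real ^ 'n) * exp (- \<epsilon> * (norm x)\<^sup>2)) \<partial>lborel)
        = ennreal (LINT x|lborel. frac_kernel \<alpha> t (x :: real ^ 'n) * exp (- \<epsilon> * (norm x)\<^sup>2))"
      by (intro nn_integral_eq_integral ix AE_I2 mult_nonneg_nonneg frac_kernel_nonneg \<alpha> t) auto
    moreover have "(LINT x|lborel. frac_kernel \<alpha> t (x :: real ^ 'n) * exp (- \<epsilon> * (norm x)\<^sup>2)) \<le> ?M"
    proof -
      have "(LINT x|lborel. frac_kernel \<alpha> t (x :: real ^ 'n) * exp (- \<epsilon> * (norm x)\<^sup>2)) = (LINT y|lborel. LINT x|lborel. ?g x y)"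
        unfolding inner[symmetric] by (rule lborel_pair.Fubini_integral[OF int, symmetric])
      also have "\<dots> = (LINT y|lborel. (2 * pi) powr (- real n / 2) * (?e y * (sqrt (pi / \<epsilon>) ^ n * exp (- (norm y)\<^sup>2 / (4 * \<epsilon>)))))"
      proof (rule Bochner_Integration.integral_cong[OF refl])
        fix y :: "real ^ 'n"
        have "(LINT x|lborel. ?g x y) = (2 * pi) powr (- real n / 2) * (?e y * (LINT x|lborel. cos (y \<bullet> x) * exp (- \<epsilon> * (norm x)\<^sup>2)))"
          unfolding integral_mult_right_zero[symmetric]
          by (rule Bochner_Integration.integral_cong) (auto simp: inner_commute mult_ac)
        then show "(LINT x|lborel. ?g x y) = (2 * pi) powr (- real n / 2) * (?e y * (sqrt (pi / \<epsilon>) ^ n * exp (- (norm y)\<^sup>2 / (4 * \<epsilon>))))"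
          using has_bochner_integral_cos_gaussian[OF \<epsilon>, of y, THEN has_bochner_integral_integral_eq] by (simp add: n_def)
      qed
      \<comment> \<open>Bounding \<open>?e y\<close> by 1 leaves a pure Gaussian in
        \<open>y\<close>. Then \<open>\<epsilon>\<close> cancels, since
        \<open>sqrt (pi / \<epsilon>) * sqrt (4 * pi * \<epsilon>) = 2 * pi\<close> in each
        coordinate.\<close>
      also have "\<dots> \<le> (LINT y|lborel. (2 * pi) powr (- real n / 2) * (sqrt (pi / \<epsilon>) ^ n * exp (- (1 / (4 * \<epsilon>)) * (norm (y::real ^ 'n))\<^sup>2)))"
      proof (rule integral_mono')
        show "integrable lborel (\<lambda>y::real ^ 'n. (2 * pi) powr (- real n / 2) * (sqrt (pi / \<epsilon>) ^ n * exp (- (1 / (4 * \<epsilon>)) * (norm y)\<^sup>2)))"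
          using \<epsilon> by (intro integrable_mult_right integrable_gaussian) auto
        show "(2 * pi) powr (- real n / 2) * (?e y * (sqrt (pi / \<epsilon>) ^ n * exp (- (norm y)\<^sup>2 / (4 * \<epsilon>))))
          \<le> (2 * pi) powr (- real n / 2) * (sqrt (pi / \<epsilon>) ^ n * exp (- (1 / (4 * \<epsilon>)) * (norm y)\<^sup>2))" for y
        proof (rule mult_left_mono)
          have "?e y * (sqrt (pi / \<epsilon>) ^ n * exp (- (norm y)\<^sup>2 / (4 * \<epsilon>))) \<le> 1 * (sqrt (pi / \<epsilon>) ^ n * exp (- (norm y)\<^sup>2 / (4 * \<epsilon>)))"
            using \<epsilon> t by (intro mult_right_mono) auto
          then show "?e y * (sqrt (pi / \<epsilon>) ^ n * exp (- (norm y)\<^sup>2 / (4 * \<epsilon>))) \<le> sqrt (pi / \<epsilon>) ^ n * exp (- (1 / (4 * \<epsilon>)) * (norm y)\<^sup>2)"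
            by simp
        qed simp
      qed (use \<epsilon> in auto)
      also have "\<dots> = (2 * pi) powr (- real n / 2) * (sqrt (pi / \<epsilon>) ^ n * sqrt (pi / (1 / (4 * \<epsilon>))) ^ n)"
        using integrable_gaussian(2)[of "1 / (4 * \<epsilon>)", where 'a="real ^ 'n"] \<epsilon> by (simp add: n_def)
      also have "sqrt (pi / \<epsilon>) ^ n * sqrt (pi / (1 / (4 * \<epsilon>))) ^ n = (2 * pi) powr real n"
      proof -
        have "sqrt (pi / \<epsilon>) * sqrt (pi / (1 / (4 * \<epsilon>))) = sqrt ((2 * pi)\<^sup>2)"
          unfolding real_sqrt_mult[symmetric] using \<epsilon> by (simp add: field_simps power2_eq_square)
        also have "\<dots> = 2 * pi" unfolding real_sqrt_abs by simp
        finally show ?thesis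
          unfolding power_mult_distrib[symmetric] by (simp add: powr_realpow)
      qed
      also have "(2 * pi) powr (- real n / 2) * (2 * pi) powr real n = ?M"
        by (simp add: powr_add[symmetric])
      finally show ?thesis .
    qed
    ultimately show ?thesis by (simp add: ennreal_leI)
  qed
  \<comment> \<open>Fatou's lemma along \<open>\<epsilon> = 1 / (j + 1)\<close> removes the
    regularization.\<close>
  let ?F = "\<lambda>j (x::real ^ 'n). ennreal (frac_kernel \<alpha> t x * exp (- inverse (real (Suc j)) * (norm x)\<^sup>2))"
  have "(\<integral>\<^sup>+ x. ennreal (frac_kernel \<alpha> t (x :: real ^ 'n)) \<partial>lborel) = (\<integral>\<^sup>+ x. liminf (\<lambda>j. ?F j x) \<partial>lborel)"
  proof (rule nn_integral_cong)
    fix x :: "real ^ 'n"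
    have "(\<lambda>j. frac_kernel \<alpha> t x * exp (- inverse (real (Suc j)) * (norm x)\<^sup>2)) \<longlonglongrightarrow> frac_kernel \<alpha> t x * exp (- 0 * (norm x)\<^sup>2)"
      by (intro tendsto_intros LIMSEQ_inverse_real_of_nat)
    then have "(\<lambda>j. ?F j x) \<longlonglongrightarrow> ennreal (frac_kernel \<alpha> t x)"
      by (intro tendsto_ennrealI) simp
    then show "ennreal (frac_kernel \<alpha> t x) = liminf (\<lambda>j. ?F j x)"
      by (intro lim_imp_Liminf[symmetric]) auto
  qed
  also have "\<dots> \<le> liminf (\<lambda>j. integral\<^sup>N lborel (?F j))"
    by (rule nn_integral_liminf) simp
  also have "\<dots> \<le> liminf (\<lambda>_. ennreal ?M)"
    by (intro Liminf_mono always_eventually allI bound) simp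
  also have "\<dots> = ennreal ?M" by (simp add: Liminf_const)
  finally show ?thesis by (simp add: n_def)
qed


section \<open>Weighted Hoelder inequalities\<close>

text \<open>The convex function \<open>x powr p\<close> lies above its tangent at \<open>l\<close>;
  solved for \<open>x\<close>, this is the claim. It is Young's inequality for
  \<open>(x / l) powr p\<close> and 1.\<close>

lemma tangent_powr_le:
  fixes x l p :: real
  assumes "0 \<le> x" "0 < l" "1 \<le> p"
  shows "x \<le> l powr (1 - p) / p * x powr p + (1 - 1 / p) * l"
proof (cases "x = 0")
  case False
  with assms have x: "0 < x" by simp
  have "((x / l) powr p) powr (1 / p) * 1 powr (1 - 1 / p) \<le> (1 / p) * (x / l) powr p + (1 - 1 / p) * 1"
    using assms x by (intro Youngs_inequality_0) auto
  then have "x / l \<le> (1 / p) * (x / l) powr p + (1 - 1 / p)"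
    using assms x by (simp add: powr_powr)
  then have "l * (x / l) \<le> l * ((1 / p) * (x / l) powr p + (1 - 1 / p))"
    using assms by (intro mult_left_mono) auto
  also have "\<dots> = l powr (1 - p) / p * x powr p + (1 - 1 / p) * l"
    using assms x by (simp add: powr_divide powr_diff algebra_simps)
  finally show ?thesis using assms by simp
qed (use assms in \<open>auto simp: field_simps\<close>)

text \<open>Integrating the tangent bound against \<open>w\<close> gives
  \<open>a * A + b * W\<close> for every \<open>l\<close>; the choice
  \<open>l = (A / W) powr (1 / p)\<close> makes it the claimed product, with \<open>p = 1\<close>
  included.\<close>

lemma nn_integral_weighted_Hoelder:
  fixes w g :: "'a \<Rightarrow> real"
  assumes [measurable]: "w \<in> borel_measurable M" "g \<in> borel_measurable M"
    and w0: "\<And>x. 0 \<le> w x" and g0: "\<And>x. 0 \<le> g x" and p: "1 \<le> p" and W0: "0 \<le> W" and A0: "0 \<le> A"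
    and W: "(\<integral>\<^sup>+x. ennreal (w x) \<partial>M) \<le> ennreal W"
    and A: "(\<integral>\<^sup>+x. ennreal (w x * g x powr p) \<partial>M) \<le> ennreal A"
  shows "(\<integral>\<^sup>+x. ennreal (w x * g x) \<partial>M) \<le> ennreal (W powr (1 - 1 / p) * A powr (1 / p))"
proof (cases "W = 0 \<or> A = 0")
  case True
  \<comment> \<open>Here the right-hand side is 0, even for \<open>W = 0\<close> and
    \<open>p = 1\<close>, as \<open>0 powr 0 = 0\<close>; so \<open>w * g\<close> has to vanish
    almost everywhere.\<close>
  then have "AE x in M. w x * g x = 0"
  proof
    assume "W = 0"
    then have "(\<integral>\<^sup>+x. ennreal (w x) \<partial>M) = 0" using W by simp
    then have "AE x in M. ennreal (w x) = 0" by (subst (asm) nn_integral_0_iff_AE) auto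
    then show ?thesis by eventually_elim (use w0 in \<open>simp add: ennreal_eq_0_iff order_antisym\<close>)
  next
    assume "A = 0"
    then have "(\<integral>\<^sup>+x. ennreal (w x * g x powr p) \<partial>M) = 0" using A by simp
    then have "AE x in M. ennreal (w x * g x powr p) = 0" by (subst (asm) nn_integral_0_iff_AE) auto
    then show ?thesis
    proof eventually_elim
      case (elim x)
      then have "w x * g x powr p \<le> 0" by (simp only: ennreal_eq_0_iff)
      with mult_nonneg_nonneg[OF w0[of x] powr_ge_zero[of "g x" p]]
      have "w x * g x powr p = 0" by linarith
      then show ?case by auto
    qed
  qed
  then have "(\<integral>\<^sup>+x. ennreal (w x * g x) \<partial>M) = 0"
    by (subst nn_integral_0_iff_AE) auto
  then show ?thesis by simp
next
  case False
  with W0 A0 have pos: "0 < W" "0 < A" by auto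
  define l where "l = (A / W) powr (1 / p)"
  have l: "0 < l" using pos by (simp add: l_def)
  have lp: "l powr p = A / W" using pos p by (simp add: l_def powr_powr)
  define a where "a = l powr (1 - p) / p"
  define b where "b = (1 - 1 / p) * l"
  have a: "0 \<le> a" and b: "0 \<le> b" using p l by (auto simp: a_def b_def field_simps)
  have "(\<integral>\<^sup>+x. ennreal (w x * g x) \<partial>M) \<le> (\<integral>\<^sup>+x. ennreal a * ennreal (w x * g x powr p) + ennreal b * ennreal (w x) \<partial>M)"
  proof (rule nn_integral_mono)
    fix x
    have "w x * g x \<le> w x * (a * g x powr p + b)"
      using w0 tangent_powr_le[OF g0 l p] by (intro mult_left_mono) (auto simp: a_def b_def)
    also have "\<dots> = a * (w x * g x powr p) + b * w x" by (simp add: algebra_simps)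
    finally have "ennreal (w x * g x) \<le> ennreal (a * (w x * g x powr p) + b * w x)"
      by (rule ennreal_leI)
    also have "\<dots> = ennreal a * ennreal (w x * g x powr p) + ennreal b * ennreal (w x)"
      using a b w0[of x] by (simp add: ennreal_mult)
    finally show "ennreal (w x * g x) \<le> ennreal a * ennreal (w x * g x powr p) + ennreal b * ennreal (w x)" .
  qed
  also have "\<dots> = ennreal a * (\<integral>\<^sup>+x. ennreal (w x * g x powr p) \<partial>M) + ennreal b * (\<integral>\<^sup>+x. ennreal (w x) \<partial>M)"
    by (subst nn_integral_add) (auto simp: nn_integral_cmult)
  also have "\<dots> \<le> ennreal a * ennreal A + ennreal b * ennreal W"
    by (intro add_mono mult_left_mono W A) auto
  also have "\<dots> = ennreal (a * A + b * W)"
    using a b pos by (simp add: ennreal_mult)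
  also have "a * A + b * W = W powr (1 - 1 / p) * A powr (1 / p)"
  proof -
    have "l powr (1 - p) * A = l * W"
      using l lp pos by (simp add: powr_diff field_simps)
    then have "a * A + b * W = l * W"
      using p by (simp add: a_def b_def field_simps)
    also have "\<dots> = W powr (1 - 1 / p) * A powr (1 / p)"
      using pos by (simp add: l_def powr_divide powr_diff)
    finally show ?thesis .
  qed
  finally show ?thesis .
qed

text \<open>The weighted inequality for the weight \<open>f powr b\<close> and the function
  \<open>g * f powr (1 - b)\<close>, with \<open>b = q / (q - 1)\<close> the conjugate exponent. As
  \<open>b + (1 - b) * q = 0\<close>, the powers of \<open>f\<close> disappear from the second
  integral.\<close>

lemma nn_integral_Hoelder:
  fixes f g :: "'a \<Rightarrow> real"
  assumes [measurable]: "f \<in> borel_measurable M" "g \<in> borel_measurable M"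
    and f0: "\<And>x. 0 \<le> f x" and g0: "\<And>x. 0 \<le> g x" and q: "1 < q" and W0: "0 \<le> W" and A0: "0 \<le> A"
    and W: "(\<integral>\<^sup>+x. ennreal (f x powr (q / (q - 1))) \<partial>M) \<le> ennreal W"
    and A: "(\<integral>\<^sup>+x. ennreal (g x powr q) \<partial>M) \<le> ennreal A"
  shows "(\<integral>\<^sup>+x. ennreal (f x * g x) \<partial>M) \<le> ennreal (W powr (1 - 1 / q) * A powr (1 / q))"
proof -
  define b where "b = q / (q - 1)"
  have b: "b + (1 - b) * q = 0" using q by (simp add: b_def field_simps)
  have "(\<integral>\<^sup>+x. ennreal (f x powr b * (g x * f x powr (1 - b))) \<partial>M) \<le> ennreal (W powr (1 - 1 / q) * A powr (1 / q))"
  proof (rule nn_integral_weighted_Hoelder)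
    show "(\<integral>\<^sup>+x. ennreal (f x powr b * (g x * f x powr (1 - b)) powr q) \<partial>M) \<le> ennreal A"
    proof (rule order_trans[OF nn_integral_mono A])
      fix x
      have "f x powr b * (g x * f x powr (1 - b)) powr q \<le> g x powr q"
      proof (cases "f x = 0")
        case False
        have "f x powr b * (g x * f x powr (1 - b)) powr q = g x powr q * f x powr (b + (1 - b) * q)"
          unfolding powr_add using f0 g0 by (simp add: powr_mult powr_powr)
        then show ?thesis using False by (simp add: b)
      qed simp
      then show "ennreal (f x powr b * (g x * f x powr (1 - b)) powr q) \<le> ennreal (g x powr q)"
        by (rule ennreal_leI)
    qed
  qed (use W W0 A0 q g0 in \<open>auto simp: b_def\<close>)
  moreover have "f x powr b * (g x * f x powr (1 - b)) = f x * g x" for x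
  proof (cases "f x = 0")
    case False
    have "f x powr b * (g x * f x powr (1 - b)) = g x * f x powr (b + (1 - b))"
      unfolding powr_add by simp
    then show ?thesis using False f0[of x] by simp
  qed simp
  ultimately show ?thesis by simp
qed

section \<open>Translations and convolutions\<close>

lemma nn_integral_lborel_diff:
  fixes f :: "'a::euclidean_space \<Rightarrow> ennreal"
  assumes [measurable]: "f \<in> borel_measurable borel"
  shows "(\<integral>\<^sup>+y. f (x - y) \<partial>lborel) = integral\<^sup>N lborel f" "(\<integral>\<^sup>+y. f (y - x) \<partial>lborel) = integral\<^sup>N lborel f"
proof -
  have "integral\<^sup>N lborel f = (\<integral>\<^sup>+y. f (x + (- 1) *\<^sub>R y) \<partial>lborel)"
    by (subst lborel_affine[of "- 1" x]) (simp_all add: nn_integral_density nn_integral_distr)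
  then show "(\<integral>\<^sup>+y. f (x - y) \<partial>lborel) = integral\<^sup>N lborel f" by simp
  have "integral\<^sup>N lborel f = (\<integral>\<^sup>+y. f (- x + 1 *\<^sub>R y) \<partial>lborel)"
    by (subst lborel_affine[of 1 "- x"]) (simp_all add: nn_integral_density nn_integral_distr)
  then show "(\<integral>\<^sup>+y. f (y - x) \<partial>lborel) = integral\<^sup>N lborel f" by simp
qed

text \<open>Weighted Hoelder on the product space with weight \<open>k (x - y)\<close> restricted to
  \<open>x \<in> B\<close>. The weight has mass at most \<open>m * V\<close>; integrated over
  \<open>x\<close> alone it is at most the full mass \<open>m\<close> and at most volume times
  supremum \<open>V * L\<close>, whence the minimum.\<close>

lemma nn_integral_convolution_le:
  fixes k f :: "'a::euclidean_space \<Rightarrow> real"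
  assumes [measurable]: "k \<in> borel_measurable borel" "f \<in> borel_measurable borel" "B \<in> sets borel"
    and k0: "\<And>x. 0 \<le> k x" and f0: "\<And>x. 0 \<le> f x" and p: "1 \<le> p"
    and B: "emeasure lborel B = ennreal V" and V: "0 \<le> V"
    and kL: "\<And>x. k x \<le> L" and kM: "(\<integral>\<^sup>+x. ennreal (k x) \<partial>lborel) \<le> ennreal m" and m: "0 \<le> m"
    and A: "(\<integral>\<^sup>+x. ennreal (f x powr p) \<partial>lborel) \<le> ennreal A" and A0: "0 \<le> A"
  shows "(\<integral>\<^sup>+x\<in>B. (\<integral>\<^sup>+y. ennreal (k (x - y) * f y) \<partial>lborel) \<partial>lborel)
    \<le> ennreal ((m * V) powr (1 - 1 / p) * (min m (V * L) * A) powr (1 / p))"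
proof -
  let ?w = "\<lambda>(x, y). indicator B x * k (x - y)"
  have L: "0 \<le> L" using k0[of 0] kL[of 0] by linarith
  have Vi: "(\<integral>\<^sup>+x. indicator B x \<partial>lborel) = ennreal V" by (simp add: B)
  have W: "(\<integral>\<^sup>+z. ennreal (?w z) \<partial>(lborel \<Otimes>\<^sub>M lborel)) \<le> ennreal (m * V)"
  proof -
    have "(\<integral>\<^sup>+z. ennreal (?w z) \<partial>(lborel \<Otimes>\<^sub>M lborel)) = (\<integral>\<^sup>+x. (\<integral>\<^sup>+y. indicator B x * ennreal (k (x - y)) \<partial>lborel) \<partial>lborel)"
      by (subst lborel.nn_integral_fst[symmetric]) (auto simp: ennreal_mult' ennreal_indicator)
    also have "\<dots> = (\<integral>\<^sup>+x. indicator B x * (\<integral>\<^sup>+y. ennreal (k y) \<partial>lborel) \<partial>lborel)"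
      by (subst nn_integral_cmult) (auto simp: nn_integral_lborel_diff(1)[of "\<lambda>x. ennreal (k x)"])
    also have "\<dots> = ennreal V * (\<integral>\<^sup>+y. ennreal (k y) \<partial>lborel)"
      by (subst nn_integral_multc) (auto simp: Vi)
    also have "\<dots> \<le> ennreal V * ennreal m" by (intro mult_left_mono kM) auto
    finally show ?thesis using V m by (simp add: ennreal_mult mult.commute)
  qed
  have in_x: "(\<integral>\<^sup>+x. indicator B x * ennreal (k (x - y)) \<partial>lborel) \<le> ennreal (min m (V * L))" for y
  proof -
    have "(\<integral>\<^sup>+x. indicator B x * ennreal (k (x - y)) \<partial>lborel) \<le> (\<integral>\<^sup>+x. ennreal (k (x - y)) \<partial>lborel)"
      by (intro nn_integral_mono) (auto simp: indicator_def)
    also have "\<dots> = (\<integral>\<^sup>+y. ennreal (k y) \<partial>lborel)"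
      by (simp add: nn_integral_lborel_diff(2)[of "\<lambda>x. ennreal (k x)"])
    also note kM
    finally have 1: "(\<integral>\<^sup>+x. indicator B x * ennreal (k (x - y)) \<partial>lborel) \<le> ennreal m" .
    have "(\<integral>\<^sup>+x. indicator B x * ennreal (k (x - y)) \<partial>lborel) \<le> (\<integral>\<^sup>+x. indicator B x * ennreal L \<partial>lborel)"
      by (intro nn_integral_mono mult_left_mono ennreal_leI kL) auto
    also have "\<dots> = ennreal (V * L)"
      using V L by (subst nn_integral_multc) (auto simp: Vi ennreal_mult)
    finally show ?thesis using 1 by (auto simp: min_def)
  qed
  have AA: "(\<integral>\<^sup>+z. ennreal (?w z * f (snd z) powr p) \<partial>(lborel \<Otimes>\<^sub>M lborel)) \<le> ennreal (min m (V * L) * A)"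
  proof -
    have "(\<integral>\<^sup>+z. ennreal (?w z * f (snd z) powr p) \<partial>(lborel \<Otimes>\<^sub>M lborel))
        = (\<integral>\<^sup>+y. (\<integral>\<^sup>+x. ennreal (?w (x, y) * f y powr p) \<partial>lborel) \<partial>lborel)"
      by (subst lborel_pair.nn_integral_snd[symmetric]) auto
    also have "\<dots> = (\<integral>\<^sup>+y. (\<integral>\<^sup>+x. (indicator B x * ennreal (k (x - y))) * ennreal (f y powr p) \<partial>lborel) \<partial>lborel)"
      using k0 by (simp add: ennreal_mult' ennreal_mult'' ennreal_indicator)
    also have "\<dots> = (\<integral>\<^sup>+y. (\<integral>\<^sup>+x. indicator B x * ennreal (k (x - y)) \<partial>lborel) * ennreal (f y powr p) \<partial>lborel)"
      by (subst nn_integral_multc) auto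
    also have "\<dots> \<le> (\<integral>\<^sup>+y. ennreal (min m (V * L)) * ennreal (f y powr p) \<partial>lborel)"
      by (intro nn_integral_mono mult_right_mono in_x) auto
    also have "\<dots> = ennreal (min m (V * L)) * (\<integral>\<^sup>+y. ennreal (f y powr p) \<partial>lborel)"
      by (rule nn_integral_cmult) simp
    also have "\<dots> \<le> ennreal (min m (V * L)) * ennreal A" by (intro mult_left_mono A) auto
    finally show ?thesis using A0 m V L by (simp add: ennreal_mult'')
  qed
  have "(\<integral>\<^sup>+x\<in>B. (\<integral>\<^sup>+y. ennreal (k (x - y) * f y) \<partial>lborel) \<partial>lborel) =
      (\<integral>\<^sup>+x. (\<integral>\<^sup>+y. ennreal (?w (x, y) * f y) \<partial>lborel) \<partial>lborel)"
  proof (rule nn_integral_cong)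
    fix x show "(\<integral>\<^sup>+y. ennreal (k (x - y) * f y) \<partial>lborel) * indicator B x = (\<integral>\<^sup>+y. ennreal (?w (x, y) * f y) \<partial>lborel)"
      by (auto simp: indicator_def)
  qed
  also have "\<dots> = (\<integral>\<^sup>+z. ennreal (?w z * f (snd z)) \<partial>(lborel \<Otimes>\<^sub>M lborel))"
    by (subst lborel.nn_integral_fst[symmetric]) auto
  also have "\<dots> \<le> ennreal ((m * V) powr (1 - 1 / p) * (min m (V * L) * A) powr (1 / p))"
    by (rule nn_integral_weighted_Hoelder[OF _ _ _ _ p _ _ W AA]) (use k0 f0 m V L A0 in auto)
  finally show ?thesis .
qed

section \<open>Lower bound for the mixed norm\<close>

lemma ennreal_power_mono: "u \<le> v \<Longrightarrow> 0 \<le> a \<Longrightarrow> ennreal_power u a \<le> ennreal_power v a"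
  by (auto simp: ennreal_power_def top_unique less_top intro!: ennreal_leI powr_mono2 enn2real_mono)

lemma ennreal_power_ennreal: "0 \<le> x \<Longrightarrow> ennreal_power (ennreal x) a = ennreal (x powr a)"
  by (simp add: ennreal_power_def)

lemma ennreal_power_mult: "ennreal_power (ennreal_power u a) b = ennreal_power u (a * b)"
  by (simp add: ennreal_power_def powr_powr)

lemma borel_measurable_ennreal_power [measurable]:
  assumes [measurable]: "f \<in> borel_measurable M"
  shows "(\<lambda>x. ennreal_power (f x) a) \<in> borel_measurable M"
  unfolding ennreal_power_def by measurable

text \<open>The \<open>q\<close>-th power of \<open>mixed_norm\<close>: without the outer root it is
  a plain integral over time.\<close>

definition mixed_integral :: "real \<Rightarrow> real \<Rightarrow> (real \<times> (real ^ 'n::finite) \<Rightarrow> real) \<Rightarrow> ennreal"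
  where "mixed_integral p q F =
    (\<integral>\<^sup>+ t \<in> {0<..}. ennreal_power (\<integral>\<^sup>+ x. ennreal (\<bar>F (t, x)\<bar> powr p) \<partial>lborel) (q / p) \<partial>lborel)"

lemma mixed_norm_power: "ennreal_power (mixed_norm p q F) a = ennreal_power (mixed_integral p q F) (a / q)"
  by (simp add: mixed_norm_def mixed_integral_def ennreal_power_mult)

text \<open>Potential and mixed integral only see positive times, so multiplying by the indicator of
  \<open>upper_half_space\<close> changes neither; it yields the Borel measurability on the whole
  space that Tonelli requires.\<close>

lemma admissible_borel_extension:
  fixes F :: "real \<times> (real ^ 'n::finite) \<Rightarrow> real"
  assumes F: "F \<in> admissible \<alpha> K"
  obtains F' where "F' \<in> borel_measurable borel" "\<And>z. 0 \<le> F' z"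
    "\<And>t x. 0 < t \<Longrightarrow> (t, x) \<in> K \<Longrightarrow> 1 \<le> frac_potential \<alpha> F' (t, x)"
    "mixed_integral p q F' = mixed_integral p q F"
proof
  let ?U = "upper_half_space :: (real \<times> (real ^ 'n)) set"
  let ?F = "\<lambda>z. F z * indicator ?U z"
  have U: "?U = {0<..} \<times> UNIV" by (auto simp: upper_half_space_def)
  have Um: "?U \<in> sets borel" unfolding U by (intro borel_open open_Times) auto
  show "?F \<in> borel_measurable borel"
    using F Um by (simp add: admissible_def borel_measurable_restrict_space_iff mult.commute)
  show "0 \<le> ?F z" for z
    using F by (auto simp: admissible_def indicator_def)
  have pot: "frac_potential \<alpha> ?F (t, x) = frac_potential \<alpha> F (t, x)" for t x
    unfolding frac_potential_def
    by (auto intro!: nn_integral_cong simp: indicator_def U)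
  show "1 \<le> frac_potential \<alpha> ?F (t, x)" if "0 < t" "(t, x) \<in> K" for t x
  proof -
    have "indicator K (t, x) \<le> frac_potential \<alpha> F (t, x)"
    proof -
      have "(t, x) \<in> ?U" using that by (simp add: U)
      then show ?thesis using F unfolding admissible_def by blast
    qed
    then show ?thesis unfolding pot using that by simp
  qed
  show "mixed_integral p q ?F = mixed_integral p q F"
    unfolding mixed_integral_def by (auto intro!: nn_integral_cong simp: indicator_def U)
qed

text \<open>The bound \<open>W\<close> of the time integral stays a parameter, so that the power
  case and the logarithmic case share this estimate with one constant \<open>c\<close>.\<close>

lemma mixed_integral_lower_bound:
  fixes \<alpha> p q :: real
  assumes \<alpha>: "0 < \<alpha>" "\<alpha> < 1" and p: "1 \<le> p" and q: "1 < q"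
  obtains c where "0 < c"
    "\<And>t0 (x0 :: real ^ 'n::finite) \<rho> W F. 0 < t0 \<Longrightarrow> 0 < \<rho> \<Longrightarrow> 0 < W \<Longrightarrow> F \<in> admissible \<alpha> ({t0} \<times> cball x0 \<rho>) \<Longrightarrow>
      (\<integral>\<^sup>+ \<tau> \<in> {0<..<t0}. ennreal (min 1 (\<rho> powr (2 * \<alpha>) / \<tau>) powr (real CARD('n) / (2 * \<alpha> * p) * (q / (q - 1)))) \<partial>lborel) \<le> ennreal W \<Longrightarrow>
      ennreal (c * \<rho> powr (real CARD('n) * q / p) * W powr (1 - q)) \<le> mixed_integral p q F"
proof -
  define n where "n = real CARD('n)"
  define v where "v = unit_ball_vol n"
  define M0 where "M0 = (2 * pi) powr (n / 2)"
  define L0 where "L0 = frac_kernel \<alpha> 1 (0 :: real ^ 'n)"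
  \<comment> \<open>Dominates both terms of the minimum in the convolution estimate: the mass
    \<open>M0\<close> for recent times, \<open>v * L0\<close> for earlier ones.\<close>
  define C1 where "C1 = max M0 (v * L0)"
  define c1 where "c1 = (M0 * v) powr (1 - 1 / p) * C1 powr (1 / p)"
  have n: "0 < n" by (simp add: n_def)
  have v: "0 < v" using n by (simp add: v_def)
  have M0: "0 < M0" by (simp add: M0_def)
  have L0: "0 < L0" using frac_kernel_zero_pos[OF \<alpha>(1)] by (simp add: L0_def)
  have C1: "0 < C1" using M0 by (simp add: C1_def)
  have c1: "0 < c1" using M0 v C1 by (simp add: c1_def)
  show ?thesis
  \<comment> \<open>This constant comes from solving the final Hoelder inequality for
    \<open>A\<close>.\<close>
  proof (rule that[of "(v / c1) powr q"])
    show "0 < (v / c1) powr q" using v c1 by simp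
    fix t0 :: real and x0 :: "real ^ 'n" and \<rho> W :: real and F
    assume t0: "0 < t0" and \<rho>: "0 < \<rho>" and W0: "0 < W" and F: "F \<in> admissible \<alpha> ({t0} \<times> cball x0 \<rho>)"
      and W: "(\<integral>\<^sup>+ \<tau> \<in> {0<..<t0}. ennreal (min 1 (\<rho> powr (2 * \<alpha>) / \<tau>) powr (real CARD('n) / (2 * \<alpha> * p) * (q / (q - 1)))) \<partial>lborel) \<le> ennreal W"
    obtain F' where F'b: "F' \<in> borel_measurable borel" and F'0: "\<And>z. 0 \<le> F' z"
      and F'1: "\<And>t x. 0 < t \<Longrightarrow> (t, x) \<in> {t0} \<times> cball x0 \<rho> \<Longrightarrow> 1 \<le> frac_potential \<alpha> F' (t, x)"
      and F'X: "mixed_integral p q F' = mixed_integral p q F"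
      using admissible_borel_extension[OF F, of p q] by blast
    have [measurable]: "F' \<in> borel_measurable (borel \<Otimes>\<^sub>M borel)" using F'b by (simp add: borel_prod)
    define N where "N s = (\<integral>\<^sup>+ x. ennreal (F' (s, x) powr p) \<partial>lborel)" for s
    have [measurable]: "N \<in> borel_measurable borel" unfolding N_def[abs_def] by measurable
    define R where "R = \<rho> powr (2 * \<alpha>)"
    define \<kappa> where "\<kappa> = n / (2 * \<alpha> * p)"
    define m where "m s = min 1 (R / (t0 - s))" for s
    define G where "G s = enn2real (N s) powr (1 / p)" for s
    have [measurable]: "m \<in> borel_measurable borel" "G \<in> borel_measurable borel"
      unfolding m_def[abs_def] G_def[abs_def] by measurable
    let ?B = "cball x0 \<rho>" and ?I = "{0<..<t0}"
    have [measurable]: "?B \<in> sets borel" by (intro borel_closed closed_cball)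
    have R: "0 < R" using \<rho> by (simp add: R_def)
    have V: "emeasure lborel ?B = ennreal (v * \<rho> powr n)"
      using emeasure_cball[of \<rho> x0] \<rho> by (simp add: v_def n_def powr_realpow)
    have X: "mixed_integral p q F = (\<integral>\<^sup>+ s. ennreal_power (N s) (q / p) * indicator {0<..} s \<partial>lborel)"
    proof -
      have "mixed_integral p q F' = (\<integral>\<^sup>+ s. ennreal_power (N s) (q / p) * indicator {0<..} s \<partial>lborel)"
        unfolding mixed_integral_def N_def using F'0 by simp
      then show ?thesis unfolding F'X .
    qed
    show "ennreal ((v / c1) powr q * \<rho> powr (real CARD('n) * q / p) * W powr (1 - q)) \<le> mixed_integral p q F"
    proof (cases "mixed_integral p q F")
      case (real A)
      \<comment> \<open>A finite mixed integral makes \<open>N s\<close> finite at almost every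
        positive time, so \<open>enn2real\<close> in \<open>G\<close> loses nothing there.\<close>
      have fin: "AE s in lborel. 0 < s \<longrightarrow> N s \<noteq> \<infinity>"
      proof -
        have "AE s in lborel. ennreal_power (N s) (q / p) * indicator {0<..} s \<noteq> \<infinity>"
          by (rule nn_integral_PInf_AE) (use real X in auto)
        then show ?thesis
          by eventually_elim (auto simp: ennreal_power_def)
      qed
      have sp: "(\<integral>\<^sup>+x\<in>?B. (\<integral>\<^sup>+y. ennreal (frac_kernel \<alpha> (t0 - s) (x - y) * F' (s, y)) \<partial>lborel) \<partial>lborel)
          \<le> ennreal (c1 * \<rho> powr (n * (1 - 1 / p)) * (m s powr \<kappa> * G s))"
        if s: "0 < s" "s < t0" and Ns: "N s \<noteq> \<infinity>" for s
      proof -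
        define \<tau> where "\<tau> = t0 - s"
        have \<tau>: "0 < \<tau>" using s by (simp add: \<tau>_def)
        define L where "L = L0 * \<tau> powr (- n / (2 * \<alpha>))"
        define a where "a = enn2real (N s)"
        have a: "0 \<le> a" "N s = ennreal a" using Ns by (auto simp: a_def less_top)
        have L: "0 \<le> L" using L0 by (simp add: L_def)
        have 1: "(\<integral>\<^sup>+x\<in>?B. (\<integral>\<^sup>+y. ennreal (frac_kernel \<alpha> \<tau> (x - y) * F' (s, y)) \<partial>lborel) \<partial>lborel)
          \<le> ennreal ((M0 * (v * \<rho> powr n)) powr (1 - 1 / p) * (min M0 (v * \<rho> powr n * L) * a) powr (1 / p))"
        proof (rule nn_integral_convolution_le)
          show "frac_kernel \<alpha> \<tau> x \<le> L" for x :: "real ^ 'n"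
            using frac_kernel_le[OF \<alpha>(1) \<tau>, of x] by (simp add: L_def L0_def n_def)
          show "(\<integral>\<^sup>+x. ennreal (frac_kernel \<alpha> \<tau> (x :: real ^ 'n)) \<partial>lborel) \<le> ennreal M0"
            using nn_integral_frac_kernel_le[OF \<alpha> \<tau>] by (simp add: M0_def n_def)
          show "(\<integral>\<^sup>+y. ennreal (F' (s, y) powr p) \<partial>lborel) \<le> ennreal a"
            using a by (simp add: N_def)
        qed (use V v M0 a p F'0 \<alpha> \<tau> in \<open>auto intro: frac_kernel_nonneg\<close>)
        \<comment> \<open>Times at distance at least \<open>R\<close> from \<open>t0\<close> use the
          supremum bound on the kernel, whence the decay
          \<open>(R / \<tau>) powr (n / (2 * \<alpha>))\<close>; nearer times use the mass
          bound.\<close>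
        have "min M0 (v * \<rho> powr n * L) \<le> C1 * m s powr (n / (2 * \<alpha>))"
        proof (cases "R \<le> \<tau>")
          case True
          have "\<rho> powr n = R powr (n / (2 * \<alpha>))" using \<alpha> by (simp add: R_def powr_powr)
          then have "v * \<rho> powr n * L = v * L0 * (R / \<tau>) powr (n / (2 * \<alpha>))"
            using R \<tau> by (simp add: L_def powr_divide powr_minus divide_simps)
          also have "\<dots> \<le> C1 * (R / \<tau>) powr (n / (2 * \<alpha>))"
            by (intro mult_right_mono) (auto simp: C1_def)
          also have "R / \<tau> = m s" using True \<tau> by (simp add: m_def \<tau>_def[symmetric] min_def)
          finally show ?thesis by linarith
        next
          case False
          then have "m s = 1" using \<tau> by (simp add: m_def \<tau>_def[symmetric] min_def)
          then show ?thesis by (simp add: C1_def)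
        qed
        then have "(min M0 (v * \<rho> powr n * L) * a) powr (1 / p) \<le> (C1 * m s powr (n / (2 * \<alpha>)) * a) powr (1 / p)"
          using a p M0 v L by (intro powr_mono2 mult_right_mono) auto
        also have "\<dots> = C1 powr (1 / p) * (m s powr \<kappa> * G s)"
          using a(1) C1 by (simp add: powr_mult powr_powr G_def a_def \<kappa>_def mult_ac)
        finally have "(M0 * (v * \<rho> powr n)) powr (1 - 1 / p) * (min M0 (v * \<rho> powr n * L) * a) powr (1 / p)
           \<le> (M0 * (v * \<rho> powr n)) powr (1 - 1 / p) * (C1 powr (1 / p) * (m s powr \<kappa> * G s))"
          by (intro mult_left_mono) auto
        also have e: "(M0 * (v * \<rho> powr n)) powr (1 - 1 / p) = (M0 * v) powr (1 - 1 / p) * \<rho> powr (n * (1 - 1 / p))"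
          using M0 v \<rho> by (simp add: powr_mult powr_powr)
        finally have 2: "(M0 * (v * \<rho> powr n)) powr (1 - 1 / p) * (min M0 (v * \<rho> powr n * L) * a) powr (1 / p)
           \<le> c1 * \<rho> powr (n * (1 - 1 / p)) * (m s powr \<kappa> * G s)"
          unfolding e by (simp add: c1_def mult_ac)
        show ?thesis
          using order_trans[OF 1 ennreal_leI[OF 2]] by (simp add: \<tau>_def)
      qed
      define D where "D = c1 * \<rho> powr (n * (1 - 1 / p))"
      have D: "0 < D" using c1 \<rho> by (simp add: D_def)
      \<comment> \<open>The potential is at least 1 on the slice, so its integral over the ball is
        at least the volume; Tonelli then moves the time integral outside.\<close>
      have "ennreal (v * \<rho> powr n) = (\<integral>\<^sup>+x\<in>?B. 1 \<partial>lborel)" using V by simp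
      also have "\<dots> \<le> (\<integral>\<^sup>+x\<in>?B. frac_potential \<alpha> F' (t0, x) \<partial>lborel)"
        using F'1[OF t0] by (intro nn_integral_mono) (auto simp: indicator_def)
      also have "\<dots> = (\<integral>\<^sup>+x. (\<integral>\<^sup>+s. (\<integral>\<^sup>+y. ennreal (frac_kernel \<alpha> (t0 - s) (x - y) * F' (s, y)) \<partial>lborel) * indicator ?I s * indicator ?B x \<partial>lborel) \<partial>lborel)"
        by (simp add: frac_potential_def nn_integral_multc)
      also have "\<dots> = (\<integral>\<^sup>+s. (\<integral>\<^sup>+x. (\<integral>\<^sup>+y. ennreal (frac_kernel \<alpha> (t0 - s) (x - y) * F' (s, y)) \<partial>lborel) * indicator ?I s * indicator ?B x \<partial>lborel) \<partial>lborel)"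
        by (rule lborel_pair.Fubini') measurable
      also have "\<dots> = (\<integral>\<^sup>+s\<in>?I. (\<integral>\<^sup>+x\<in>?B. (\<integral>\<^sup>+y. ennreal (frac_kernel \<alpha> (t0 - s) (x - y) * F' (s, y)) \<partial>lborel) \<partial>lborel) \<partial>lborel)"
        by (intro nn_integral_cong) (auto simp: indicator_def)
      also have "\<dots> \<le> (\<integral>\<^sup>+s. ennreal D * ennreal ((indicator ?I s * m s powr \<kappa>) * (indicator ?I s * G s)) \<partial>lborel)"
      proof (rule nn_integral_mono_AE, use fin in eventually_elim)
        case (elim s)
        then show ?case
          using sp[of s] D by (auto simp: indicator_def D_def ennreal_mult'[symmetric])
      qed
      also have "\<dots> = ennreal D * (\<integral>\<^sup>+s. ennreal ((indicator ?I s * m s powr \<kappa>) * (indicator ?I s * G s)) \<partial>lborel)"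
        by (rule nn_integral_cmult) simp
      also have "\<dots> \<le> ennreal D * ennreal (W powr (1 - 1 / q) * A powr (1 / q))"
      proof (rule mult_left_mono, rule nn_integral_Hoelder[OF _ _ _ _ q])
        show "(\<integral>\<^sup>+s. ennreal ((indicator ?I s * m s powr \<kappa>) powr (q / (q - 1))) \<partial>lborel) \<le> ennreal W"
        proof -
          \<comment> \<open>The reflection \<open>\<tau> = t0 - s\<close> maps
            \<open>{0<..<t0}\<close> to itself and produces the integral bounded by
            \<open>W\<close>.\<close>
          let ?h = "\<lambda>\<tau>. ennreal (min 1 (R / \<tau>) powr (\<kappa> * (q / (q - 1)))) * indicator ?I \<tau>"
          have "(\<integral>\<^sup>+s. ennreal ((indicator ?I s * m s powr \<kappa>) powr (q / (q - 1))) \<partial>lborel) = (\<integral>\<^sup>+s. ?h (t0 - s) \<partial>lborel)"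
            by (intro nn_integral_cong) (auto simp: indicator_def powr_powr m_def)
          also have "\<dots> = integral\<^sup>N lborel ?h"
            by (rule nn_integral_lborel_diff) simp
          finally show ?thesis using W by (simp add: R_def \<kappa>_def n_def)
        qed
        show "(\<integral>\<^sup>+s. ennreal ((indicator ?I s * G s) powr q) \<partial>lborel) \<le> ennreal A"
        proof -
          have "(\<integral>\<^sup>+s. ennreal ((indicator ?I s * G s) powr q) \<partial>lborel) \<le> mixed_integral p q F"
            unfolding X
          proof (rule nn_integral_mono_AE, use fin in eventually_elim)
            case (elim s)
            then show ?case
              using q by (auto simp: indicator_def G_def powr_powr ennreal_power_def)
          qed
          then show ?thesis using real by simp
        qed
      qed (use W0 real in \<open>auto simp: G_def\<close>)
      also have "\<dots> = ennreal (D * (W powr (1 - 1 / q) * A powr (1 / q)))"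
        using D by (simp add: ennreal_mult')
      finally have "v * \<rho> powr n \<le> D * (W powr (1 - 1 / q) * A powr (1 / q))"
        using D by (subst (asm) ennreal_le_iff) auto
      also have "D * (W powr (1 - 1 / q) * A powr (1 / q)) = \<rho> powr n * (c1 * \<rho> powr (- n / p) * W powr (1 - 1 / q) * A powr (1 / q))"
      proof -
        have "\<rho> powr (n * (1 - 1 / p)) = \<rho> powr n * \<rho> powr (- n / p)"
          by (simp add: powr_add[symmetric] algebra_simps)
        then show ?thesis by (simp add: D_def mult_ac)
      qed
      finally have "v \<le> c1 * \<rho> powr (- n / p) * W powr (1 - 1 / q) * A powr (1 / q)"
        using \<rho> by (simp add: mult.commute[of v])
      then have "v / c1 * \<rho> powr (n / p) * W powr (1 / q - 1) \<le> A powr (1 / q)"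
      proof -
        assume le: "v \<le> c1 * \<rho> powr (- n / p) * W powr (1 - 1 / q) * A powr (1 / q)"
        have "v / c1 * \<rho> powr (n / p) * W powr (1 / q - 1)
          \<le> (c1 * \<rho> powr (- n / p) * W powr (1 - 1 / q) * A powr (1 / q)) / c1 * \<rho> powr (n / p) * W powr (1 / q - 1)"
          using le c1 by (intro mult_right_mono divide_right_mono) auto
        also have "\<dots> = A powr (1 / q) * (\<rho> powr (- n / p) * \<rho> powr (n / p)) * (W powr (1 - 1 / q) * W powr (1 / q - 1))"
          using c1 by simp
        also have "\<rho> powr (- n / p) * \<rho> powr (n / p) = 1"
          using \<rho> by (simp add: powr_add[symmetric])
        also have "W powr (1 - 1 / q) * W powr (1 / q - 1) = 1"
          using W0 by (simp add: powr_add[symmetric])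
        finally show ?thesis by simp
      qed
      then have "(v / c1 * \<rho> powr (n / p) * W powr (1 / q - 1)) powr q \<le> (A powr (1 / q)) powr q"
        using q v c1 by (intro powr_mono2) auto
      also have "\<dots> = A" using real q by (simp add: powr_powr)
      also have "(v / c1 * \<rho> powr (n / p) * W powr (1 / q - 1)) powr q = (v / c1) powr q * \<rho> powr (n * q / p) * W powr (1 - q)"
      proof -
        have *: "(1 / q - 1) * q = 1 - q" using q by (simp add: field_simps)
        have "(u * \<rho> powr (n / p) * W powr (1 / q - 1)) powr q = u powr q * \<rho> powr (n / p * q) * W powr ((1 / q - 1) * q)"
          if "0 \<le> u" for u
          using that by (simp add: powr_mult powr_powr)
        from this[of "v / c1"] show ?thesis using v c1 unfolding * by simp
      qed
      finally show ?thesis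
        using real by (simp add: n_def)
    qed simp
  qed
qed


section \<open>Capacity of parabolic balls\<close>

lemma nn_integral_inverse_Icc:
  fixes a b :: real
  assumes "0 < a" "a \<le> b"
  shows "(\<integral>\<^sup>+\<sigma>\<in>{a..b}. ennreal (1 / \<sigma>) \<partial>lborel) = ennreal (ln (b / a))"
proof -
  have "(\<integral>\<^sup>+\<sigma>\<in>{a..b}. ennreal (1 / \<sigma>) \<partial>lborel) = ennreal (ln b - ln a)"
    using assms by (intro nn_integral_FTC_Icc) (auto intro!: derivative_eq_intros simp: field_simps)
  then show ?thesis using assms by (simp add: ln_div)
qed

text \<open>Split at \<open>\<tau> = R\<close>: the first piece contributes at most
  \<open>R\<close>, and for \<open>\<beta> > 1\<close> the rest converges even over
  \<open>{R..}\<close>, which frees the bound of \<open>t\<close>.\<close>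

lemma nn_integral_min_powr_le:
  fixes R \<beta> t :: real
  assumes R: "0 < R" and \<beta>: "1 < \<beta>"
  shows "(\<integral>\<^sup>+\<tau>\<in>{0<..<t}. ennreal (min 1 (R / \<tau>) powr \<beta>) \<partial>lborel) \<le> ennreal (R * (\<beta> / (\<beta> - 1)))"
proof -
  have "has_bochner_integral lborel (\<lambda>\<tau>. indicator {R..} \<tau> * \<tau> powr (- \<beta>)) (- (R powr (- \<beta> + 1)) / (- \<beta> + 1))"
    using assms by (intro has_bochner_integral_lborel_nonneg has_integral_powr_to_inf) auto
  then have tail: "(\<integral>\<^sup>+\<tau>. ennreal (indicator {R..} \<tau> * \<tau> powr (- \<beta>)) \<partial>lborel) = ennreal (- (R powr (- \<beta> + 1)) / (- \<beta> + 1))"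
    by (subst nn_integral_eq_integral) (auto simp: has_bochner_integral_iff)
  have "(\<integral>\<^sup>+\<tau>\<in>{0<..<t}. ennreal (min 1 (R / \<tau>) powr \<beta>) \<partial>lborel)
      \<le> (\<integral>\<^sup>+\<tau>. indicator {0..R} \<tau> + ennreal (R powr \<beta>) * ennreal (indicator {R..} \<tau> * \<tau> powr (- \<beta>)) \<partial>lborel)"
  proof (rule nn_integral_mono)
    fix \<tau> :: real
    consider "\<tau> \<le> 0" | "0 < \<tau>" "\<tau> \<le> R" | "R < \<tau>" by linarith
    then show "ennreal (min 1 (R / \<tau>) powr \<beta>) * indicator {0<..<t} \<tau>
        \<le> indicator {0..R} \<tau> + ennreal (R powr \<beta>) * ennreal (indicator {R..} \<tau> * \<tau> powr (- \<beta>))"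
    proof cases
      case 2
      then have "min 1 (R / \<tau>) = 1" by (simp add: min_def)
      then show ?thesis using 2 by (auto simp: indicator_def)
    next
      case 3
      then have "min 1 (R / \<tau>) = R / \<tau>" using R by (simp add: min_def)
      moreover have "(R / \<tau>) powr \<beta> = R powr \<beta> * \<tau> powr (- \<beta>)"
        using 3 R by (simp add: powr_divide powr_minus field_simps)
      ultimately show ?thesis using 3 by (auto simp: indicator_def ennreal_mult)
    qed (simp add: indicator_def)
  qed
  also have "\<dots> = ennreal R + ennreal (R powr \<beta>) * ennreal (- (R powr (- \<beta> + 1)) / (- \<beta> + 1))"
    using R by (subst nn_integral_add) (auto simp: nn_integral_cmult tail)
  also have "- (R powr (- \<beta> + 1)) / (- \<beta> + 1) = R powr (1 - \<beta>) / (\<beta> - 1)"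
    using \<beta> by (simp add: field_simps)
  also have "ennreal R + ennreal (R powr \<beta>) * ennreal (R powr (1 - \<beta>) / (\<beta> - 1)) = ennreal (R + R powr \<beta> * (R powr (1 - \<beta>) / (\<beta> - 1)))"
    using R \<beta> by (subst ennreal_mult[symmetric]) auto
  also have "R + R powr \<beta> * (R powr (1 - \<beta>) / (\<beta> - 1)) = R * (\<beta> / (\<beta> - 1))"
  proof -
    have "R powr \<beta> * R powr (1 - \<beta>) = R" using R by (simp add: powr_add[symmetric])
    then show ?thesis using \<beta> by (simp add: field_simps)
  qed
  finally show ?thesis .
qed

text \<open>The borderline exponent: after the same split the tail \<open>R / \<tau>\<close> has to
  stop at \<open>t\<close> and contributes a logarithm. \<open>powr 1\<close> is the shape left once
  \<open>\<beta>\<close> is rewritten to 1.\<close>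

lemma nn_integral_min_inverse_le:
  fixes R t :: real
  assumes R: "0 < R" and t: "R \<le> t"
  shows "(\<integral>\<^sup>+\<tau>\<in>{0<..<t}. ennreal (min 1 (R / \<tau>) powr 1) \<partial>lborel) \<le> ennreal (R * (1 + ln (t / R)))"
proof -
  have "(\<integral>\<^sup>+\<tau>\<in>{0<..<t}. ennreal (min 1 (R / \<tau>) powr 1) \<partial>lborel)
      \<le> (\<integral>\<^sup>+\<tau>. indicator {0..R} \<tau> + ennreal R * (ennreal (1 / \<tau>) * indicator {R..t} \<tau>) \<partial>lborel)"
  proof (rule nn_integral_mono)
    fix \<tau> :: real
    consider "\<tau> \<le> 0" | "0 < \<tau>" "\<tau> \<le> R" | "R < \<tau>" by linarith
    then show "ennreal (min 1 (R / \<tau>) powr 1) * indicator {0<..<t} \<tau>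
        \<le> indicator {0..R} \<tau> + ennreal R * (ennreal (1 / \<tau>) * indicator {R..t} \<tau>)"
    proof cases
      case 2
      then have "min 1 (R / \<tau>) = 1" by (simp add: min_def)
      then show ?thesis using 2 by (auto simp: indicator_def)
    next
      case 3
      then have "min 1 (R / \<tau>) powr 1 = R * (1 / \<tau>)" using R by (simp add: min_def)
      then show ?thesis using 3 R by (auto simp: indicator_def ennreal_mult[symmetric])
    qed (simp add: indicator_def)
  qed
  also have "\<dots> = ennreal R + ennreal R * ennreal (ln (t / R))"
    using R t by (subst nn_integral_add) (auto simp: nn_integral_cmult nn_integral_inverse_Icc)
  also have "\<dots> = ennreal (R * (1 + ln (t / R)))"
    using R t by (simp add: ennreal_mult distrib_left)
  finally show ?thesis .
qed

section \<open>Reduction of the capacity to mixed integrals\<close>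

lemma open_parabolic_ball: "open (parabolic_ball \<alpha> r t0 (x0 :: real ^ 'n::finite))"
proof -
  have "parabolic_ball \<alpha> r t0 x0 =
      {z. 0 < fst z \<and> \<bar>fst z - t0\<bar> < r powr (2 * \<alpha>) \<and> norm (snd z - x0) < r}"
    by (auto simp: parabolic_ball_def upper_half_space_def)
  also have "open \<dots>"
    by (intro open_Collect_conj open_Collect_less continuous_intros)
  finally show ?thesis .
qed

lemma capacity_parabolic_ball:
  "capacity \<alpha> p q (parabolic_ball \<alpha> r t0 (x0 :: real ^ 'n::finite)) = open_capacity \<alpha> p q (parabolic_ball \<alpha> r t0 x0)"
  by (rule capacity_open[OF open_parabolic_ball]) (auto simp: parabolic_ball_def)

text \<open>A compact slice inside the ball enters the supremum, hence its capacity is a lower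
  bound. The exponent \<open>min p q / q\<close> turns the mixed integral into the power of the norm
  that defines capacity.\<close>

lemma capacity_parabolic_ball_ge:
  fixes x0 :: "real ^ 'n::finite"
  assumes "0 < r" "0 < t0" "0 < p" "0 < q" "0 \<le> a"
    and F: "\<And>F. F \<in> admissible \<alpha> ({t0} \<times> cball x0 (r / 2)) \<Longrightarrow> ennreal a \<le> mixed_integral p q F"
  shows "ennreal (a powr (min p q / q)) \<le> capacity \<alpha> p q (parabolic_ball \<alpha> r t0 x0)"
proof -
  have "ennreal (a powr (min p q / q)) \<le> compact_capacity \<alpha> p q ({t0} \<times> cball x0 (r / 2))"
    unfolding compact_capacity_def
  proof (rule INF_greatest)
    fix F assume "F \<in> admissible \<alpha> ({t0} \<times> cball x0 (r / 2))"
    from ennreal_power_mono[OF F[OF this], of "min p q / q"] assms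
    show "ennreal (a powr (min p q / q)) \<le> ennreal_power (mixed_norm p q F) (min p q)"
      by (simp add: mixed_norm_power ennreal_power_ennreal)
  qed
  also have "\<dots> \<le> open_capacity \<alpha> p q (parabolic_ball \<alpha> r t0 x0)"
    unfolding open_capacity_def using assms
    by (intro SUP_upper)
       (auto intro!: compact_Times simp: parabolic_ball_def upper_half_space_def dist_norm norm_minus_commute)
  finally show ?thesis by (simp add: capacity_parabolic_ball)
qed

text \<open>One \<open>F\<close> admissible for every subset of the ball bounds all infima in the
  supremum by the same number.\<close>

lemma capacity_parabolic_ball_le:
  fixes x0 :: "real ^ 'n::finite"
  assumes "0 < p" "0 < q" "0 \<le> a"
    and F: "\<And>K. K \<subseteq> parabolic_ball \<alpha> r t0 x0 \<Longrightarrow> F \<in> admissible \<alpha> K"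
    and a: "mixed_integral p q F \<le> ennreal a"
  shows "capacity \<alpha> p q (parabolic_ball \<alpha> r t0 x0) \<le> ennreal (a powr (min p q / q))"
  unfolding capacity_parabolic_ball open_capacity_def
proof (rule SUP_least, clarify)
  fix K assume "K \<subseteq> parabolic_ball \<alpha> r t0 x0"
  then have "compact_capacity \<alpha> p q K \<le> ennreal_power (mixed_norm p q F) (min p q)"
    unfolding compact_capacity_def by (intro INF_lower F)
  also have "\<dots> \<le> ennreal_power (ennreal a) (min p q / q)"
    unfolding mixed_norm_power using assms by (intro ennreal_power_mono) auto
  finally show "compact_capacity \<alpha> p q K \<le> ennreal (a powr (min p q / q))"
    using assms by (simp add: ennreal_power_ennreal)
qed

section \<open>The test function on a paraboloid\<close>

text \<open>With \<open>\<sigma> = t0 - s\<close>, each slice of the paraboloid carries a fixed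
  amount of kernel mass, so the height \<open>h / \<sigma>\<close> adds a multiple of
  \<open>h / \<sigma>\<close> to the potential; integration over \<open>\<sigma>\<close> yields the
  logarithm that \<open>h\<close> normalizes. The end \<open>b\<close> stays free to serve both
  cases.\<close>

lemma ex_admissible_parabolic_ball:
  fixes \<alpha> p q :: real
  assumes \<alpha>: "0 < \<alpha>" "\<alpha> < 1" and p: "1 \<le> p" and q: "1 < q"
  obtains C where "0 < C"
    "\<And>t0 (x0 :: real ^ 'n::finite) r b. 0 < r \<Longrightarrow> 2 * r powr (2 * \<alpha>) < b \<Longrightarrow> b < t0 \<Longrightarrow>
      \<exists>F. (\<forall>K. K \<subseteq> parabolic_ball \<alpha> r t0 x0 \<longrightarrow> F \<in> admissible \<alpha> K) \<and>
        mixed_integral p q F \<le> ennreal (C * ln (b / (2 * r powr (2 * \<alpha>))) powr (- q)) *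
          (\<integral>\<^sup>+\<sigma>\<in>{2 * r powr (2 * \<alpha>)..b}. ennreal (\<sigma> powr (real CARD('n) * q / (2 * \<alpha> * p) - q)) \<partial>lborel)"
proof -
  define n where "n = real CARD('n)"
  define v where "v = unit_ball_vol n"
  have n: "0 < n" by (simp add: n_def)
  have v: "0 < v" using n by (simp add: v_def)
  have vol: "emeasure lborel (cball x \<rho>) = ennreal (v * \<rho> powr n)" if "0 < \<rho>" for x :: "real ^ 'n" and \<rho>
    using emeasure_cball[of \<rho> x] that by (simp add: v_def n_def powr_realpow)
  have volI: "(\<integral>\<^sup>+y. ennreal a * indicator (cball x \<rho>) y \<partial>lborel) = ennreal (a * (v * \<rho> powr n))"
    if "0 < \<rho>" "0 \<le> a" for x :: "real ^ 'n" and \<rho> a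
    using that v by (subst nn_integral_cmult_indicator) (auto simp: vol ennreal_mult')
  obtain c d where c: "0 < c" and d: "0 < d" and K: "\<And>t x. 0 < t \<Longrightarrow> norm (x :: real ^ 'n) \<le> d * t powr (1 / (2 * \<alpha>)) \<Longrightarrow>
      c * t powr (- real CARD('n) / (2 * \<alpha>)) \<le> frac_kernel \<alpha> t x"
    using frac_kernel_ge[OF \<alpha>(1), where 'n='n] by blast
  \<comment> \<open>\<open>c\<close> bounds the kernel, \<open>v * d powr n\<close> is the volume
    factor of the ball where this bound is used, and the power of 3 is the loss from
    \<open>t - s \<le> 3 * (\<sigma> / 2)\<close> against a radius built from
    \<open>\<sigma> / 2\<close>.\<close>
  define c' where "c' = c * v * d powr n * 3 powr (- n / (2 * \<alpha>))"
  have c': "0 < c'" using c v d by (simp add: c'_def)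
  define C2 where "C2 = (v * (1 + d) powr n) powr (q / p)"
  have C2: "0 < C2" using v d by (simp add: C2_def)
  show ?thesis
  proof (rule that[of "C2 * c' powr (- q)"])
    show "0 < C2 * c' powr (- q)" using C2 c' by simp
    fix t0 r b :: real and x0 :: "real ^ 'n"
    assume r: "0 < r" and b: "2 * r powr (2 * \<alpha>) < b" and t0: "b < t0"
    define R where "R = r powr (2 * \<alpha>)"
    have R: "0 < R" using r by (simp add: R_def)
    have rR: "r = R powr (1 / (2 * \<alpha>))" using r \<alpha> by (simp add: R_def powr_powr)
    have b: "2 * R < b" using b by (simp add: R_def)
    define \<Phi> where "\<Phi> = ln (b / (2 * R))"
    have \<Phi>: "0 < \<Phi>" using b R by (simp add: \<Phi>_def)
    \<comment> \<open>Chosen so that the lower bound \<open>c' * h * \<Phi>\<close> for the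
      potential equals 1.\<close>
    define h where "h = 1 / (c' * \<Phi>)"
    have h: "0 < h" using c' \<Phi> by (simp add: h_def)
    define S where "S s \<longleftrightarrow> 2 * R \<le> t0 - s \<and> t0 - s \<le> b" for s
    \<comment> \<open>The factor \<open>1 + d\<close> leaves room for two displacements: from
      \<open>x0\<close> to \<open>x\<close>, less than
      \<open>r \<le> \<sigma> powr (1 / (2 * \<alpha>))\<close>, and from \<open>x\<close> to
      \<open>y\<close>, at most \<open>d * \<sigma> powr (1 / (2 * \<alpha>))\<close>.\<close>
    define F where "F z = (if S (fst z) \<and> norm (snd z - x0) \<le> (1 + d) * (t0 - fst z) powr (1 / (2 * \<alpha>)) then h / (t0 - fst z) else 0)"
      for z :: "real \<times> (real ^ 'n)"
    have F0: "0 \<le> F z" for z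
      using h R by (auto simp: F_def S_def)
    have Fm: "F \<in> borel_measurable borel"
    proof -
      have m: "(\<lambda>z :: real \<times> (real ^ 'n). t0 - fst z) \<in> borel_measurable borel"
        "(\<lambda>z :: real \<times> (real ^ 'n). norm (snd z - x0)) \<in> borel_measurable borel"
        by (intro borel_measurable_continuous_onI continuous_intros)+
      have s: "{z \<in> space borel. S (fst z) \<and> norm (snd z - x0) \<le> (1 + d) * (t0 - fst z) powr (1 / (2 * \<alpha>))} \<in> sets borel"
        unfolding S_def
        by (intro sets.sets_Collect_conj borel_measurable_le borel_measurable_const borel_measurable_times powr_real_measurable m)
      show ?thesis unfolding F_def[abs_def]
        by (rule measurable_If[OF _ _ s]) (intro borel_measurable_divide borel_measurable_const m)+
    qed
    have pot: "1 \<le> frac_potential \<alpha> F (t, x)" if tx: "(t, x) \<in> parabolic_ball \<alpha> r t0 x0" for t x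
    proof -
      have t: "t - t0 < R" "t0 - t < R" and x: "norm (x - x0) < r"
        using tx by (auto simp: parabolic_ball_def R_def)
      have inner: "ennreal (c' * (h / (t0 - s))) \<le> (\<integral>\<^sup>+y. ennreal (frac_kernel \<alpha> (t - s) (x - y) * F (s, y)) \<partial>lborel)"
        and st: "0 < s \<and> s < t" if s: "S s" for s
      proof -
        define \<sigma> where "\<sigma> = t0 - s"
        have \<sigma>: "2 * R \<le> \<sigma>" "\<sigma> \<le> b" using s by (auto simp: S_def \<sigma>_def)
        then have \<sigma>0: "0 < \<sigma>" using R by linarith
        \<comment> \<open>\<open>b < t0\<close> keeps \<open>s\<close> positive, and
          \<open>\<sigma> \<ge> 2 * R\<close> keeps it below every \<open>t\<close> in the
          ball.\<close>
        show st: "0 < s \<and> s < t" using \<sigma> t t0 R unfolding \<sigma>_def by linarith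
        have "t - s = \<sigma> + (t - t0)" by (simp add: \<sigma>_def)
        \<comment> \<open>\<open>\<bar>t - t0\<bar> < R \<le> \<sigma> / 2\<close> makes
          \<open>t - s\<close> comparable to \<open>\<sigma>\<close>.\<close>
        then have "\<sigma> \<le> 2 * (t - s)" "2 * (t - s) \<le> 3 * \<sigma>" using \<sigma> t by simp_all
        then have ts: "\<sigma> / 2 \<le> t - s" "t - s \<le> 3 * (\<sigma> / 2)" by simp_all
        define \<rho> where "\<rho> = d * (\<sigma> / 2) powr (1 / (2 * \<alpha>))"
        have \<rho>: "0 < \<rho>" using d \<sigma>0 by (simp add: \<rho>_def)
        have le: "c * (3 * (\<sigma> / 2)) powr (- n / (2 * \<alpha>)) * (h / \<sigma>) \<le> frac_kernel \<alpha> (t - s) (x - y) * F (s, y)"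
          if y: "y \<in> cball x \<rho>" for y
        proof (rule mult_mono)
          have xy: "norm (x - y) \<le> \<rho>" using y by (simp add: dist_norm)
          have "\<rho> \<le> d * (t - s) powr (1 / (2 * \<alpha>))"
            unfolding \<rho>_def using ts d \<sigma>0 \<alpha> by (intro mult_left_mono powr_mono2) auto
          then have "c * (t - s) powr (- n / (2 * \<alpha>)) \<le> frac_kernel \<alpha> (t - s) (x - y)"
            using K[of "t - s" "x - y"] xy st by (simp add: n_def)
          moreover have "(3 * (\<sigma> / 2)) powr (- n / (2 * \<alpha>)) \<le> (t - s) powr (- n / (2 * \<alpha>))"
            using ts n \<alpha> st by (intro powr_mono2') auto
          ultimately show "c * (3 * (\<sigma> / 2)) powr (- n / (2 * \<alpha>)) \<le> frac_kernel \<alpha> (t - s) (x - y)"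
            using mult_left_mono[of _ _ c] c by (meson less_imp_le order_trans)
          have "norm (y - x0) \<le> norm (x - y) + norm (x - x0)"
            using norm_triangle_ineq[of "y - x" "x - x0"] by (simp add: norm_minus_commute)
          also have "\<dots> \<le> \<rho> + r" using xy x by linarith
          also have "\<dots> \<le> d * \<sigma> powr (1 / (2 * \<alpha>)) + \<sigma> powr (1 / (2 * \<alpha>))"
            unfolding \<rho>_def rR using d \<sigma>0 \<sigma> R \<alpha> by (intro add_mono mult_left_mono powr_mono2) auto
          also have "\<dots> = (1 + d) * (t0 - s) powr (1 / (2 * \<alpha>))" by (simp add: \<sigma>_def algebra_simps)
          finally show "h / \<sigma> \<le> F (s, y)" using s by (simp add: F_def \<sigma>_def)
          show "0 \<le> frac_kernel \<alpha> (t - s) (x - y)" using st by (intro frac_kernel_nonneg \<alpha>) auto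
          show "0 \<le> h / \<sigma>" using h \<sigma>0 by simp
        qed
        \<comment> \<open>The powers of \<open>\<sigma>\<close> in the kernel bound and in the
          volume of the ball cancel.\<close>
        have "c' * (h / (t0 - s)) = c * (3 * (\<sigma> / 2)) powr (- n / (2 * \<alpha>)) * (h / \<sigma>) * (v * \<rho> powr n)"
        proof -
          have "(3 * (\<sigma> / 2)) powr (- n / (2 * \<alpha>)) * \<rho> powr n
              = 3 powr (- n / (2 * \<alpha>)) * d powr n * ((\<sigma> / 2) powr (- n / (2 * \<alpha>)) * (\<sigma> / 2) powr (n / (2 * \<alpha>)))"
            using d \<sigma>0 by (simp add: \<rho>_def powr_mult powr_powr del: times_divide_eq_right)
          also have "(\<sigma> / 2) powr (- n / (2 * \<alpha>)) * (\<sigma> / 2) powr (n / (2 * \<alpha>)) = 1"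
            unfolding powr_add[symmetric] using \<sigma>0 by simp
          finally show ?thesis by (simp add: c'_def \<sigma>_def[symmetric])
        qed
        also have "ennreal \<dots> = (\<integral>\<^sup>+y. ennreal (c * (3 * (\<sigma> / 2)) powr (- n / (2 * \<alpha>)) * (h / \<sigma>)) * indicator (cball x \<rho>) y \<partial>lborel)"
          using c h \<sigma>0 by (intro volI[OF \<rho>, symmetric]) auto
        also have "\<dots> \<le> (\<integral>\<^sup>+y. ennreal (frac_kernel \<alpha> (t - s) (x - y) * F (s, y)) \<partial>lborel)"
        proof (rule nn_integral_mono)
          fix y
          show "ennreal (c * (3 * (\<sigma> / 2)) powr (- n / (2 * \<alpha>)) * (h / \<sigma>)) * indicator (cball x \<rho>) y
            \<le> ennreal (frac_kernel \<alpha> (t - s) (x - y) * F (s, y))"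
            using le[of y] by (cases "y \<in> cball x \<rho>") (auto intro!: ennreal_leI)
        qed
        finally show "ennreal (c' * (h / (t0 - s))) \<le> (\<integral>\<^sup>+y. ennreal (frac_kernel \<alpha> (t - s) (x - y) * F (s, y)) \<partial>lborel)" .
      qed
      let ?g = "\<lambda>\<sigma>. ennreal (c' * h) * (ennreal (1 / \<sigma>) * indicator {2 * R..b} \<sigma>)"
      have "1 = ennreal (c' * h) * ennreal \<Phi>"
        using c' \<Phi> h by (simp add: h_def ennreal_mult[symmetric] del: ennreal_mult)
      also have "\<dots> = integral\<^sup>N lborel ?g"
        using R b by (subst nn_integral_cmult) (auto simp: nn_integral_inverse_Icc \<Phi>_def)
      also have "\<dots> = (\<integral>\<^sup>+s. ?g (t0 - s) \<partial>lborel)"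
        by (rule nn_integral_lborel_diff(1)[symmetric]) simp
      also have "\<dots> \<le> frac_potential \<alpha> F (t, x)"
        unfolding frac_potential_def prod.case
      proof (rule nn_integral_mono)
        fix s
        show "?g (t0 - s) \<le> (\<integral>\<^sup>+y. ennreal (frac_kernel \<alpha> (t - s) (x - y) * F (s, y)) \<partial>lborel) * indicator {0<..<t} s"
        proof (cases "S s")
          case True
          then have "?g (t0 - s) = ennreal (c' * (h / (t0 - s)))"
            using c' h R by (auto simp: S_def ennreal_mult[symmetric])
          then show ?thesis using inner[OF True] st[OF True] by simp
        qed (auto simp: S_def)
      qed
      finally show ?thesis .
    qed
    have adm: "F \<in> admissible \<alpha> K" if "K \<subseteq> parabolic_ball \<alpha> r t0 x0" for K
      unfolding admissible_def
    proof (intro CollectI conjI ballI)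
      show "F \<in> borel_measurable (restrict_space borel upper_half_space)"
        by (rule measurable_restrict_space1[OF Fm])
      show "indicator K z \<le> frac_potential \<alpha> F z" for z
        using pot[of "fst z" "snd z"] that by (cases "z \<in> K") auto
    qed (rule F0)
    let ?e = "n * q / (2 * \<alpha> * p) - q"
    let ?g = "\<lambda>\<sigma>. ennreal (h powr q * C2) * (ennreal (\<sigma> powr ?e) * indicator {2 * R..b} \<sigma>)"
    have "mixed_integral p q F \<le> (\<integral>\<^sup>+s. ?g (t0 - s) \<partial>lborel)"
      unfolding mixed_integral_def
    proof (rule nn_integral_mono)
      fix s :: real
      show "ennreal_power (\<integral>\<^sup>+ x. ennreal (\<bar>F (s, x)\<bar> powr p) \<partial>lborel) (q / p) * indicator {0<..} s \<le> ?g (t0 - s)"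
      proof (cases "S s")
        case True
        define \<sigma> where "\<sigma> = t0 - s"
        have \<sigma>0: "0 < \<sigma>" using True R by (auto simp: S_def \<sigma>_def)
        define \<rho> where "\<rho> = (1 + d) * \<sigma> powr (1 / (2 * \<alpha>))"
        have \<rho>: "0 < \<rho>" using d \<sigma>0 by (simp add: \<rho>_def)
        have "(\<integral>\<^sup>+ x. ennreal (\<bar>F (s, x)\<bar> powr p) \<partial>lborel) = (\<integral>\<^sup>+ x. ennreal ((h / \<sigma>) powr p) * indicator (cball x0 \<rho>) x \<partial>lborel)"
          using True h \<sigma>0 p
          by (intro nn_integral_cong) (auto simp: F_def \<sigma>_def[symmetric] \<rho>_def indicator_def dist_norm norm_minus_commute)
        also have "\<dots> = ennreal ((h / \<sigma>) powr p * (v * \<rho> powr n))"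
          by (rule volI[OF \<rho>]) simp
        finally have "ennreal_power (\<integral>\<^sup>+ x. ennreal (\<bar>F (s, x)\<bar> powr p) \<partial>lborel) (q / p)
            = ennreal (((h / \<sigma>) powr p * (v * \<rho> powr n)) powr (q / p))"
          using v by (simp add: ennreal_power_ennreal)
        \<comment> \<open>Height \<open>h / \<sigma>\<close> on a ball of volume proportional to
          \<open>\<sigma> powr (n / (2 * \<alpha>))\<close>: this is the source of the exponent
          \<open>?e\<close>.\<close>
        also have "((h / \<sigma>) powr p * (v * \<rho> powr n)) powr (q / p) = h powr q * C2 * \<sigma> powr ?e"
        proof -
          have "\<rho> powr n = (1 + d) powr n * \<sigma> powr (n / (2 * \<alpha>))"
            using d \<sigma>0 by (simp add: \<rho>_def powr_mult powr_powr)
          then have 1: "(h / \<sigma>) powr p * (v * \<rho> powr n) = (h / \<sigma>) powr p * ((v * (1 + d) powr n) * \<sigma> powr (n / (2 * \<alpha>)))"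
            by (simp add: mult_ac)
          have 2: "(a powr p * (u * \<sigma> powr (n / (2 * \<alpha>)))) powr (q / p) = a powr q * (u powr (q / p) * \<sigma> powr (n * q / (2 * \<alpha> * p)))"
            if "0 \<le> a" "0 \<le> u" for a u
            using p that by (simp add: powr_mult powr_powr)
          have 3: "(h / \<sigma>) powr q = h powr q * \<sigma> powr (- q)"
            using h \<sigma>0 by (simp add: powr_divide powr_minus_divide)
          have 4: "\<sigma> powr (- q) * \<sigma> powr (n * q / (2 * \<alpha> * p)) = \<sigma> powr ?e"
            by (simp add: powr_add[symmetric])
          have "((h / \<sigma>) powr p * (v * \<rho> powr n)) powr (q / p) = (h / \<sigma>) powr q * (C2 * \<sigma> powr (n * q / (2 * \<alpha> * p)))"
            unfolding 1 C2_def using h \<sigma>0 v d by (intro 2) auto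
          also have "\<dots> = h powr q * C2 * (\<sigma> powr (- q) * \<sigma> powr (n * q / (2 * \<alpha> * p)))"
            unfolding 3 by (simp only: mult_ac)
          finally show ?thesis unfolding 4 .
        qed
        finally show ?thesis
          using True h C2 by (auto simp: \<sigma>_def S_def indicator_def ennreal_mult)
      next
        case False
        then have "(\<integral>\<^sup>+ x. ennreal (\<bar>F (s, x)\<bar> powr p) \<partial>lborel) = 0"
          by (simp add: F_def)
        then show ?thesis by (simp add: ennreal_power_def)
      qed
    qed
    also have "\<dots> = integral\<^sup>N lborel ?g"
      by (rule nn_integral_lborel_diff(1)) simp
    also have "\<dots> = ennreal (h powr q * C2) * (\<integral>\<^sup>+\<sigma>\<in>{2 * R..b}. ennreal (\<sigma> powr ?e) \<partial>lborel)"
      by (rule nn_integral_cmult) simp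
    also have "h powr q * C2 = C2 * c' powr (- q) * \<Phi> powr (- q)"
      using c' \<Phi> by (simp add: h_def powr_divide powr_mult powr_minus divide_simps)
    finally have *: "mixed_integral p q F \<le> ennreal (C2 * c' powr (- q) * \<Phi> powr (- q)) * (\<integral>\<^sup>+\<sigma>\<in>{2 * R..b}. ennreal (\<sigma> powr ?e) \<partial>lborel)" .
    show "\<exists>F. (\<forall>K. K \<subseteq> parabolic_ball \<alpha> r t0 x0 \<longrightarrow> F \<in> admissible \<alpha> K) \<and>
        mixed_integral p q F \<le> ennreal (C2 * c' powr (- q) * ln (b / (2 * r powr (2 * \<alpha>))) powr (- q)) *
          (\<integral>\<^sup>+\<sigma>\<in>{2 * r powr (2 * \<alpha>)..b}. ennreal (\<sigma> powr (real CARD('n) * q / (2 * \<alpha> * p) - q)) \<partial>lborel)"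
    proof (intro exI[of _ F] conjI allI impI)
      show "F \<in> admissible \<alpha> K" if "K \<subseteq> parabolic_ball \<alpha> r t0 x0" for K
        using that by (rule adm)
    qed (use * in \<open>simp only: R_def \<Phi>_def n_def\<close>)
  qed
qed

text \<open>The ratio \<open>\<sigma> / R\<close> lies between 1 and 4 here; the absolute value of
  \<open>e\<close> covers both signs of the exponent.\<close>

lemma nn_integral_powr_dyadic_le:
  fixes R e :: real
  assumes R: "0 < R"
  shows "(\<integral>\<^sup>+\<sigma>\<in>{2 * R..4 * R}. ennreal (\<sigma> powr e) \<partial>lborel) \<le> ennreal (2 * 4 powr \<bar>e\<bar> * R powr (e + 1))"
proof -
  have "(\<integral>\<^sup>+\<sigma>\<in>{2 * R..4 * R}. ennreal (\<sigma> powr e) \<partial>lborel)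
      \<le> (\<integral>\<^sup>+\<sigma>. ennreal (R powr e * 4 powr \<bar>e\<bar>) * indicator {2 * R..4 * R} \<sigma> \<partial>lborel)"
  proof (rule nn_integral_mono)
    fix \<sigma> :: real
    show "ennreal (\<sigma> powr e) * indicator {2 * R..4 * R} \<sigma> \<le> ennreal (R powr e * 4 powr \<bar>e\<bar>) * indicator {2 * R..4 * R} \<sigma>"
    proof (cases "\<sigma> \<in> {2 * R..4 * R}")
      case True
      then have x: "1 \<le> \<sigma> / R" "\<sigma> / R \<le> 4" using R by (auto simp: field_simps)
      have "\<sigma> powr e = R powr e * (\<sigma> / R) powr e" using R True by (simp add: powr_divide)
      also have "\<dots> \<le> R powr e * 4 powr \<bar>e\<bar>"
      proof (rule mult_left_mono)
        have "(\<sigma> / R) powr e \<le> (\<sigma> / R) powr \<bar>e\<bar>" using x by (intro powr_mono) auto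
        also have "\<dots> \<le> 4 powr \<bar>e\<bar>" using x by (intro powr_mono2) auto
        finally show "(\<sigma> / R) powr e \<le> 4 powr \<bar>e\<bar>" .
      qed simp
      finally show ?thesis using True by (simp add: ennreal_leI)
    qed simp
  qed
  also have "\<dots> = ennreal (R powr e * 4 powr \<bar>e\<bar>) * ennreal (2 * R)"
    using R by (subst nn_integral_cmult_indicator) auto
  also have "\<dots> = ennreal (2 * 4 powr \<bar>e\<bar> * R powr (e + 1))"
    using R by (simp add: ennreal_mult[symmetric] powr_add mult_ac)
  finally show ?thesis .
qed

section \<open>The power and the logarithmic asymptotics\<close>

text \<open>Positivity of \<open>E0\<close> amounts to \<open>\<beta> > 1\<close>, so the time
  integral is at most a multiple of \<open>r powr (2 * \<alpha>)\<close>. Both bounds on the mixed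
  integral scale like \<open>r powr (q * E0)\<close>, and the power \<open>\<theta>\<close> gives
  the claim.\<close>

lemma capacity_parabolic_ball_power:
  fixes \<alpha> p q :: real
  assumes \<alpha>: "0 < \<alpha>" "\<alpha> < 1" and p: "1 \<le> p" and q: "1 < q"
    and E: "real CARD('n::finite) / p + 2 * \<alpha> / q - 2 * \<alpha> > 0"
  shows "\<exists>c1 > 0. \<exists>c2 > 0. \<forall>t0 > 0. \<forall>x0 :: real ^ 'n. \<exists>\<rho> > 0. \<forall>r. 0 < r \<and> r < \<rho> \<longrightarrow>
          ennreal (c1 * r powr (min p q * (real CARD('n) / p + 2 * \<alpha> / q - 2 * \<alpha>)))
            \<le> capacity \<alpha> p q (parabolic_ball \<alpha> r t0 x0) \<and>
          capacity \<alpha> p q (parabolic_ball \<alpha> r t0 x0)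
            \<le> ennreal (c2 * r powr (min p q * (real CARD('n) / p + 2 * \<alpha> / q - 2 * \<alpha>)))"
proof -
  define n where "n = real CARD('n)"
  define E0 where "E0 = n / p + 2 * \<alpha> / q - 2 * \<alpha>"
  define \<theta> where "\<theta> = min p q / q"
  define \<beta> where "\<beta> = n / (2 * \<alpha> * p) * (q / (q - 1))"
  define e where "e = n * q / (2 * \<alpha> * p) - q"
  have n: "0 < n" by (simp add: n_def)
  have E0: "0 < E0" using E by (simp add: E0_def n_def)
  have \<theta>: "0 < \<theta>" "q * E0 * \<theta> = min p q * E0" using p q by (auto simp: \<theta>_def)
  have qE: "q * E0 = n * q / p + 2 * \<alpha> * (1 - q)" using q by (simp add: E0_def field_simps)
  have eE: "2 * \<alpha> * (e + 1) = q * E0" using \<alpha> p q by (simp add: e_def E0_def field_simps)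
  have \<beta>: "1 < \<beta>"
  proof -
    have "0 < n * q / p + 2 * \<alpha> * (1 - q)" using E0 q qE[symmetric] by simp
    then have "2 * \<alpha> * (q - 1) < n * q / p" by (simp add: algebra_simps)
    then have "1 < n * q / p / (2 * \<alpha> * (q - 1))" using \<alpha> q by (subst less_divide_eq_1_pos) auto
    also have "\<dots> = \<beta>" by (simp add: \<beta>_def)
    finally show ?thesis .
  qed
  obtain cl where cl: "0 < cl" and lower:
    "\<And>t0 (x0 :: real ^ 'n) \<rho> W F. 0 < t0 \<Longrightarrow> 0 < \<rho> \<Longrightarrow> 0 < W \<Longrightarrow> F \<in> admissible \<alpha> ({t0} \<times> cball x0 \<rho>) \<Longrightarrow>
      (\<integral>\<^sup>+ \<tau> \<in> {0<..<t0}. ennreal (min 1 (\<rho> powr (2 * \<alpha>) / \<tau>) powr (real CARD('n) / (2 * \<alpha> * p) * (q / (q - 1)))) \<partial>lborel) \<le> ennreal W \<Longrightarrow>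
      ennreal (cl * \<rho> powr (real CARD('n) * q / p) * W powr (1 - q)) \<le> mixed_integral p q F"
    using mixed_integral_lower_bound[OF \<alpha> p q, where 'n='n] by blast
  obtain Cu where Cu: "0 < Cu" and upper:
    "\<And>t0 (x0 :: real ^ 'n) r b. 0 < r \<Longrightarrow> 2 * r powr (2 * \<alpha>) < b \<Longrightarrow> b < t0 \<Longrightarrow>
      \<exists>F. (\<forall>K. K \<subseteq> parabolic_ball \<alpha> r t0 x0 \<longrightarrow> F \<in> admissible \<alpha> K) \<and>
        mixed_integral p q F \<le> ennreal (Cu * ln (b / (2 * r powr (2 * \<alpha>))) powr (- q)) *
          (\<integral>\<^sup>+\<sigma>\<in>{2 * r powr (2 * \<alpha>)..b}. ennreal (\<sigma> powr (real CARD('n) * q / (2 * \<alpha> * p) - q)) \<partial>lborel)"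
    using ex_admissible_parabolic_ball[OF \<alpha> p q, where 'n='n] by blast
  define B where "B = \<beta> / (\<beta> - 1)"
  have B: "0 < B" using \<beta> by (simp add: B_def)
  \<comment> \<open>From the slice of radius \<open>r / 2\<close> with
    \<open>W = (r / 2) powr (2 * \<alpha>) * B\<close>.\<close>
  define D1 where "D1 = cl * B powr (1 - q) * (1 / 2) powr (q * E0)"
  have D1: "0 < D1" using cl B by (simp add: D1_def)
  \<comment> \<open>\<open>ln 2\<close> is the logarithm of
    \<open>b / (2 * r powr (2 * \<alpha>))\<close> for \<open>b = 4 * r powr (2 * \<alpha>)\<close>;
    the last factor comes from the dyadic integral.\<close>
  define D2 where "D2 = Cu * ln 2 powr (- q) * (2 * 4 powr \<bar>e\<bar>)"
  have D2: "0 < D2" using Cu by (simp add: D2_def)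
  have low: "ennreal (D1 powr \<theta> * r powr (min p q * E0)) \<le> capacity \<alpha> p q (parabolic_ball \<alpha> r t0 x0)"
    if r: "0 < r" and t0: "0 < t0" for r t0 and x0 :: "real ^ 'n"
  proof -
    have "ennreal ((D1 * r powr (q * E0)) powr (min p q / q)) \<le> capacity \<alpha> p q (parabolic_ball \<alpha> r t0 x0)"
    proof (rule capacity_parabolic_ball_ge[OF r t0])
      fix F assume F: "F \<in> admissible \<alpha> ({t0} \<times> cball x0 (r / 2))"
      have "ennreal (cl * (r / 2) powr (n * q / p) * ((r / 2) powr (2 * \<alpha>) * B) powr (1 - q)) \<le> mixed_integral p q F"
        using nn_integral_min_powr_le[OF _ \<beta>, of "(r / 2) powr (2 * \<alpha>)" t0] r
        by (intro lower[folded n_def, folded \<beta>_def, OF t0 _ _ F] mult_pos_pos B) (simp_all add: B_def)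
      also have "cl * (r / 2) powr (n * q / p) * ((r / 2) powr (2 * \<alpha>) * B) powr (1 - q)
          = cl * B powr (1 - q) * (r / 2) powr (n * q / p + 2 * \<alpha> * (1 - q))"
        unfolding powr_add using B r by (simp add: powr_mult powr_powr)
      also have "\<dots> = D1 * r powr (q * E0)"
        unfolding qE[symmetric] D1_def using r by (simp add: powr_divide)
      finally show "ennreal (D1 * r powr (q * E0)) \<le> mixed_integral p q F" .
    qed (use p q D1 in auto)
    also have "(D1 * r powr (q * E0)) powr (min p q / q) = D1 powr \<theta> * r powr (min p q * E0)"
      unfolding \<theta>_def[symmetric] using D1 by (simp add: powr_mult powr_powr \<theta>(2))
    finally show ?thesis .
  qed
  have up: "capacity \<alpha> p q (parabolic_ball \<alpha> r t0 x0) \<le> ennreal (D2 powr \<theta> * r powr (min p q * E0))"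
    if r: "0 < r" and t0: "4 * r powr (2 * \<alpha>) < t0" for r t0 and x0 :: "real ^ 'n"
  proof -
    let ?R = "r powr (2 * \<alpha>)"
    have R: "0 < ?R" using r by simp
    obtain F where F: "\<And>K. K \<subseteq> parabolic_ball \<alpha> r t0 x0 \<Longrightarrow> F \<in> admissible \<alpha> K"
      and FX: "mixed_integral p q F \<le> ennreal (Cu * ln (4 * ?R / (2 * ?R)) powr (- q)) *
          (\<integral>\<^sup>+\<sigma>\<in>{2 * ?R..4 * ?R}. ennreal (\<sigma> powr e) \<partial>lborel)"
      using upper[of r "4 * ?R" t0 x0] r t0 R unfolding e_def n_def by auto
    note FX
    also have "\<dots> \<le> ennreal (Cu * ln 2 powr (- q)) * ennreal (2 * 4 powr \<bar>e\<bar> * ?R powr (e + 1))"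
      using R nn_integral_powr_dyadic_le[OF R, of e] by (intro mult_mono) auto
    also have "\<dots> = ennreal (D2 * r powr (q * E0))"
    proof -
      have "?R powr (e + 1) = r powr (q * E0)" unfolding powr_powr eE ..
      then show ?thesis using Cu by (simp add: ennreal_mult'[symmetric] D2_def mult.assoc)
    qed
    finally have "capacity \<alpha> p q (parabolic_ball \<alpha> r t0 x0) \<le> ennreal ((D2 * r powr (q * E0)) powr (min p q / q))"
      using F p q D2 by (intro capacity_parabolic_ball_le[where F=F]) auto
    also have "(D2 * r powr (q * E0)) powr (min p q / q) = D2 powr \<theta> * r powr (min p q * E0)"
      unfolding \<theta>_def[symmetric] using D2 by (simp add: powr_mult powr_powr \<theta>(2))
    finally show ?thesis .
  qed
  \<comment> \<open>The source of the threshold: the upper end \<open>b\<close> has to stay below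
    \<open>t0\<close>.\<close>
  have small: "4 * r powr (2 * \<alpha>) < t0" if "0 < r" "r < (t0 / 4) powr (1 / (2 * \<alpha>))" "0 < t0" for r t0
  proof -
    have "r powr (2 * \<alpha>) < ((t0 / 4) powr (1 / (2 * \<alpha>))) powr (2 * \<alpha>)"
      using that \<alpha> by (intro powr_less_mono2) auto
    then show ?thesis using that \<alpha> by (simp add: powr_powr)
  qed
  show ?thesis
  proof (rule exI[of _ "D1 powr \<theta>"], rule conjI, use D1 in simp,
      rule exI[of _ "D2 powr \<theta>"], intro conjI allI impI)
    fix t0 :: real and x0 :: "real ^ 'n" assume t0: "0 < t0"
    show "\<exists>\<rho>>0. \<forall>r. 0 < r \<and> r < \<rho> \<longrightarrow>
          ennreal (D1 powr \<theta> * r powr (min p q * (real CARD('n) / p + 2 * \<alpha> / q - 2 * \<alpha>)))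
            \<le> capacity \<alpha> p q (parabolic_ball \<alpha> r t0 x0) \<and>
          capacity \<alpha> p q (parabolic_ball \<alpha> r t0 x0)
            \<le> ennreal (D2 powr \<theta> * r powr (min p q * (real CARD('n) / p + 2 * \<alpha> / q - 2 * \<alpha>)))"
      unfolding n_def[symmetric] E0_def[symmetric] using t0 low up small
      by (intro exI[of _ "(t0 / 4) powr (1 / (2 * \<alpha>))"]) simp
  qed (use D1 D2 in auto)
qed

text \<open>Here \<open>\<beta> = 1\<close> and the exponent of \<open>\<sigma>\<close> is
  \<open>- 1\<close>, so all powers of \<open>r\<close> cancel and both bounds become multiples of
  \<open>l powr (1 - q)\<close> with \<open>l = ln (1 / r)\<close>.\<close>

lemma capacity_parabolic_ball_log:
  fixes \<alpha> p q :: real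
  assumes \<alpha>: "0 < \<alpha>" "\<alpha> < 1" and p: "1 \<le> p" and q: "1 < q"
    and E: "real CARD('n::finite) / p + 2 * \<alpha> / q - 2 * \<alpha> = 0"
  shows "\<exists>c1 > 0. \<exists>c2 > 0. \<forall>t0 > 0. \<forall>x0 :: real ^ 'n. \<exists>\<rho> > 0. \<forall>r. 0 < r \<and> r < \<rho> \<longrightarrow>
          ennreal (c1 * ln (1 / r) powr (min p q * (1 / q - 1)))
            \<le> capacity \<alpha> p q (parabolic_ball \<alpha> r t0 x0) \<and>
          capacity \<alpha> p q (parabolic_ball \<alpha> r t0 x0)
            \<le> ennreal (c2 * ln (1 / r) powr (min p q * (1 / q - 1)))"
proof -
  define n where "n = real CARD('n)"
  define \<theta> where "\<theta> = min p q / q"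
  have \<theta>: "(1 - q) * \<theta> = min p q * (1 / q - 1)" using p q by (simp add: \<theta>_def field_simps)
  have nqp: "n * q / p + 2 * \<alpha> * (1 - q) = 0"
  proof -
    have "q * (n / p + 2 * \<alpha> / q - 2 * \<alpha>) = n * q / p + 2 * \<alpha> * (1 - q)" using q by (simp add: field_simps)
    then show ?thesis using E by (simp add: n_def)
  qed
  then have nqp': "n * q / p = 2 * \<alpha> * (q - 1)" by (simp add: algebra_simps)
  have \<beta>: "n / (2 * \<alpha> * p) * (q / (q - 1)) = 1"
  proof -
    have "n / (2 * \<alpha> * p) * (q / (q - 1)) = (n * q / p) / (2 * \<alpha> * (q - 1))" by simp
    also have "\<dots> = 1" unfolding nqp' using \<alpha> q by simp
    finally show ?thesis .
  qed
  have e: "n * q / (2 * \<alpha> * p) - q = - 1"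
  proof -
    have "n * q / (2 * \<alpha> * p) = (n * q / p) / (2 * \<alpha>)" by simp
    also have "\<dots> = q - 1" unfolding nqp' using \<alpha> by simp
    finally show ?thesis by simp
  qed
  obtain cl where cl: "0 < cl" and lower:
    "\<And>t0 (x0 :: real ^ 'n) \<rho> W F. 0 < t0 \<Longrightarrow> 0 < \<rho> \<Longrightarrow> 0 < W \<Longrightarrow> F \<in> admissible \<alpha> ({t0} \<times> cball x0 \<rho>) \<Longrightarrow>
      (\<integral>\<^sup>+ \<tau> \<in> {0<..<t0}. ennreal (min 1 (\<rho> powr (2 * \<alpha>) / \<tau>) powr (real CARD('n) / (2 * \<alpha> * p) * (q / (q - 1)))) \<partial>lborel) \<le> ennreal W \<Longrightarrow>
      ennreal (cl * \<rho> powr (real CARD('n) * q / p) * W powr (1 - q)) \<le> mixed_integral p q F"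
    using mixed_integral_lower_bound[OF \<alpha> p q, where 'n='n] by blast
  obtain Cu where Cu: "0 < Cu" and upper:
    "\<And>t0 (x0 :: real ^ 'n) r b. 0 < r \<Longrightarrow> 2 * r powr (2 * \<alpha>) < b \<Longrightarrow> b < t0 \<Longrightarrow>
      \<exists>F. (\<forall>K. K \<subseteq> parabolic_ball \<alpha> r t0 x0 \<longrightarrow> F \<in> admissible \<alpha> K) \<and>
        mixed_integral p q F \<le> ennreal (Cu * ln (b / (2 * r powr (2 * \<alpha>))) powr (- q)) *
          (\<integral>\<^sup>+\<sigma>\<in>{2 * r powr (2 * \<alpha>)..b}. ennreal (\<sigma> powr (real CARD('n) * q / (2 * \<alpha> * p) - q)) \<partial>lborel)"
    using ex_admissible_parabolic_ball[OF \<alpha> p q, where 'n='n] by blast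
  \<comment> \<open>\<open>2 * \<alpha> + 1\<close> is what remains of
    \<open>W = R * ((2 * \<alpha> + 1) * l)\<close> besides \<open>l\<close> once the powers of
    \<open>r\<close> cancel.\<close>
  define D1 where "D1 = cl * (2 * \<alpha> + 1) powr (1 - q)"
  have D1: "0 < D1" using cl \<alpha> by (simp add: D1_def)
  define D2 where "D2 = Cu * \<alpha> powr (1 - q)"
  have D2: "0 < D2" using Cu \<alpha> by (simp add: D2_def)
  have fin: "(D * l powr (1 - q)) powr (min p q / q) = D powr \<theta> * l powr (min p q * (1 / q - 1))"
    if "0 < D" for D l
    unfolding \<theta>_def[symmetric] using that by (simp add: powr_mult powr_powr \<theta>)
  have ln2: "0 < ln (2 :: real)" "ln (2 :: real) < 1" using ln_2_less_1 by simp_all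
  \<comment> \<open>The two smallness conditions let \<open>l\<close> absorb the terms in
    \<open>ln t0\<close> and \<open>ln 2\<close>, so that \<open>t0\<close> enters the threshold but
    not the constants.\<close>
  have low: "ennreal (D1 powr \<theta> * ln (1 / r) powr (min p q * (1 / q - 1))) \<le> capacity \<alpha> p q (parabolic_ball \<alpha> r t0 x0)"
    if r: "0 < r" and t0: "0 < t0" and l1: "4 + \<bar>ln t0\<bar> < ln (1 / r)" and l2: "4 + \<bar>ln t0\<bar> < \<alpha> * ln (1 / r)"
    for r t0 and x0 :: "real ^ 'n"
  proof -
    define l where "l = ln (1 / r)"
    have l: "0 < l" using l1 unfolding l_def by linarith
    have lnr: "ln r = - l" using r by (simp add: l_def ln_div)
    define R where "R = (r / 2) powr (2 * \<alpha>)"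
    have R: "0 < R" using r by (simp add: R_def)
    have lnR: "ln R = - 2 * \<alpha> * (l + ln 2)"
      using r lnr by (simp add: R_def ln_powr ln_div algebra_simps)
    have a2: "2 * \<alpha> * ln 2 \<le> 2"
      using mult_mono[of \<alpha> 1 "ln 2" 1] \<alpha> ln2 by simp
    have a1: "0 \<le> \<alpha> * ln 2" using \<alpha> ln2 by simp
    have "ln R \<le> ln t0" using lnR l2 a1 unfolding l_def[symmetric] by (simp add: algebra_simps)
    then have Rt: "R \<le> t0" using R t0 by simp
    have "ln (t0 / R) = ln t0 + 2 * \<alpha> * l + 2 * \<alpha> * ln 2"
      using R t0 lnR by (simp add: ln_div algebra_simps)
    \<comment> \<open>\<open>1 + ln t0 + 2 * \<alpha> * ln 2 \<le> 3 + \<bar>ln t0\<bar> <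
      l\<close>.\<close>
    then have "1 + ln (t0 / R) \<le> (2 * \<alpha> + 1) * l"
      using l1 a2 unfolding l_def[symmetric] by (simp add: algebra_simps)
    then have "ennreal (R * (1 + ln (t0 / R))) \<le> ennreal (R * ((2 * \<alpha> + 1) * l))"
      using R by (intro ennreal_leI mult_left_mono) auto
    then have I: "(\<integral>\<^sup>+\<tau>\<in>{0<..<t0}. ennreal (min 1 (R / \<tau>) powr 1) \<partial>lborel) \<le> ennreal (R * ((2 * \<alpha> + 1) * l))"
      using nn_integral_min_inverse_le[OF R Rt] by (rule order_trans[rotated])
    have "ennreal ((D1 * l powr (1 - q)) powr (min p q / q)) \<le> capacity \<alpha> p q (parabolic_ball \<alpha> r t0 x0)"
    proof (rule capacity_parabolic_ball_ge[OF r t0])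
      fix F assume F: "F \<in> admissible \<alpha> ({t0} \<times> cball x0 (r / 2))"
      have "0 < R * ((2 * \<alpha> + 1) * l)" using R \<alpha> l by simp
      from lower[folded n_def, unfolded \<beta>, OF t0 _ this F] I r
      have "ennreal (cl * (r / 2) powr (n * q / p) * (R * ((2 * \<alpha> + 1) * l)) powr (1 - q)) \<le> mixed_integral p q F"
        by (simp add: R_def)
      also have "cl * (r / 2) powr (n * q / p) * (R * ((2 * \<alpha> + 1) * l)) powr (1 - q)
         = cl * (2 * \<alpha> + 1) powr (1 - q) * l powr (1 - q) * (r / 2) powr (n * q / p + 2 * \<alpha> * (1 - q))"
        unfolding powr_add R_def using r \<alpha> l by (simp add: powr_mult powr_powr)
      also have "\<dots> = D1 * l powr (1 - q)" unfolding nqp D1_def using r by simp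
      finally show "ennreal (D1 * l powr (1 - q)) \<le> mixed_integral p q F" .
    qed (use p q D1 in auto)
    then show ?thesis unfolding fin[OF D1] by (simp add: l_def)
  qed
  have up: "capacity \<alpha> p q (parabolic_ball \<alpha> r t0 x0) \<le> ennreal (D2 powr \<theta> * ln (1 / r) powr (min p q * (1 / q - 1)))"
    if r: "0 < r" and t0: "0 < t0" and l1: "4 + \<bar>ln t0\<bar> < ln (1 / r)" and l2: "4 + \<bar>ln t0\<bar> < \<alpha> * ln (1 / r)"
    for r t0 and x0 :: "real ^ 'n"
  proof -
    define l where "l = ln (1 / r)"
    have l: "0 < l" using l1 unfolding l_def by linarith
    have lnr: "ln r = - l" using r by (simp add: l_def ln_div)
    have l2: "4 + \<bar>ln t0\<bar> < \<alpha> * l" using l2 by (simp add: l_def)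
    define R where "R = r powr (2 * \<alpha>)"
    have R: "0 < R" using r by (simp add: R_def)
    have lnR: "ln R = - 2 * \<alpha> * l"
      using r lnr by (simp add: R_def ln_powr)
    \<comment> \<open>The end \<open>b = t0 / 2\<close> does not shrink with \<open>r\<close>, so
      this logarithm grows like \<open>l\<close>.\<close>
    define \<Phi> where "\<Phi> = ln (t0 / 2 / (2 * R))"
    have "ln (4 :: real) = 2 * ln 2" using ln_realpow[of 2 2] by simp
    then have "\<Phi> = ln t0 - 2 * ln 2 + 2 * \<alpha> * l"
      using R t0 lnR by (simp add: \<Phi>_def ln_div ln_mult)
    \<comment> \<open>Half of \<open>2 * \<alpha> * l\<close> absorbs
      \<open>ln t0 - 2 * ln 2\<close>.\<close>
    then have \<Phi>: "\<alpha> * l \<le> \<Phi>" using l2 ln2 by linarith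
    have al: "0 < \<alpha> * l" using \<alpha> l by simp
    then have "0 < \<Phi>" using \<Phi> by linarith
    then have b: "2 * R < t0 / 2" using R t0 by (simp add: \<Phi>_def ln_gt_zero_iff field_simps)
    obtain F where F: "\<And>K. K \<subseteq> parabolic_ball \<alpha> r t0 x0 \<Longrightarrow> F \<in> admissible \<alpha> K"
      and FX: "mixed_integral p q F \<le> ennreal (Cu * \<Phi> powr (- q)) * (\<integral>\<^sup>+\<sigma>\<in>{2 * R..t0 / 2}. ennreal (\<sigma> powr (- 1)) \<partial>lborel)"
      using upper[folded n_def, unfolded e, of r "t0 / 2" t0 x0] r t0 b unfolding R_def \<Phi>_def by auto
    have "(\<integral>\<^sup>+\<sigma>\<in>{2 * R..t0 / 2}. ennreal (\<sigma> powr (- 1)) \<partial>lborel) = (\<integral>\<^sup>+\<sigma>\<in>{2 * R..t0 / 2}. ennreal (1 / \<sigma>) \<partial>lborel)"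
      using R by (intro nn_integral_cong) (auto simp: indicator_def powr_minus_divide)
    also have "\<dots> = ennreal \<Phi>"
      using R b by (subst nn_integral_inverse_Icc) (auto simp: \<Phi>_def)
    finally have "mixed_integral p q F \<le> ennreal (Cu * \<Phi> powr (- q)) * ennreal \<Phi>"
      using FX by simp
    also have "\<dots> = ennreal (Cu * \<Phi> powr (1 - q))"
      using Cu \<open>0 < \<Phi>\<close> by (simp add: ennreal_mult[symmetric] powr_diff powr_minus_divide)
    also have "\<dots> \<le> ennreal (D2 * l powr (1 - q))"
    proof (rule ennreal_leI)
      \<comment> \<open>The exponent \<open>1 - q\<close> is negative, so a lower bound on
        \<open>\<Phi>\<close> becomes an upper bound.\<close>
      have "\<Phi> powr (1 - q) \<le> (\<alpha> * l) powr (1 - q)" using \<Phi> al q by (intro powr_mono2') auto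
      then show "Cu * \<Phi> powr (1 - q) \<le> D2 * l powr (1 - q)"
        using Cu \<alpha> l by (simp add: D2_def powr_mult)
    qed
    finally have "capacity \<alpha> p q (parabolic_ball \<alpha> r t0 x0) \<le> ennreal ((D2 * l powr (1 - q)) powr (min p q / q))"
      using F p q D2 by (intro capacity_parabolic_ball_le[where F=F]) auto
    then show ?thesis unfolding fin[OF D2] by (simp add: l_def)
  qed
  \<comment> \<open>Dividing by \<open>\<alpha> < 1\<close> in the threshold secures both conditions
    at once.\<close>
  have small: "4 + \<bar>ln t0\<bar> < ln (1 / r) \<and> 4 + \<bar>ln t0\<bar> < \<alpha> * ln (1 / r)"
    if "0 < r" "r < exp (- ((4 + \<bar>ln t0\<bar>) / \<alpha>))" for r t0
  proof -
    have "ln r < - ((4 + \<bar>ln t0\<bar>) / \<alpha>)" using that by (metis exp_gt_zero ln_exp ln_less_cancel_iff)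
    moreover have "ln (1 / r) = - ln r" using that by (simp add: ln_div)
    ultimately have 1: "(4 + \<bar>ln t0\<bar>) / \<alpha> < ln (1 / r)" by linarith
    then have "4 + \<bar>ln t0\<bar> < \<alpha> * ln (1 / r)" using \<alpha> by (simp add: field_simps)
    moreover have "4 + \<bar>ln t0\<bar> \<le> (4 + \<bar>ln t0\<bar>) / \<alpha>"
      using \<alpha> mult_left_le[of \<alpha> "4 + \<bar>ln t0\<bar>"] by (simp add: pos_le_divide_eq)
    ultimately show ?thesis using 1 by linarith
  qed
  show ?thesis
  proof (rule exI[of _ "D1 powr \<theta>"], rule conjI, use D1 in simp,
      rule exI[of _ "D2 powr \<theta>"], intro conjI allI impI)
    fix t0 :: real and x0 :: "real ^ 'n" assume t0: "0 < t0"
    show "\<exists>\<rho>>0. \<forall>r. 0 < r \<and> r < \<rho> \<longrightarrow>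
          ennreal (D1 powr \<theta> * ln (1 / r) powr (min p q * (1 / q - 1)))
            \<le> capacity \<alpha> p q (parabolic_ball \<alpha> r t0 x0) \<and>
          capacity \<alpha> p q (parabolic_ball \<alpha> r t0 x0)
            \<le> ennreal (D2 powr \<theta> * ln (1 / r) powr (min p q * (1 / q - 1)))"
    proof (intro exI[of _ "exp (- ((4 + \<bar>ln t0\<bar>) / \<alpha>))"] conjI allI impI)
      fix r assume "0 < r \<and> r < exp (- ((4 + \<bar>ln t0\<bar>) / \<alpha>))"
      with small[of r t0] have "0 < r" "4 + \<bar>ln t0\<bar> < ln (1 / r)" "4 + \<bar>ln t0\<bar> < \<alpha> * ln (1 / r)"
        by blast+
      then show "ennreal (D1 powr \<theta> * ln (1 / r) powr (min p q * (1 / q - 1))) \<le> capacity \<alpha> p q (parabolic_ball \<alpha> r t0 x0)"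
        "capacity \<alpha> p q (parabolic_ball \<alpha> r t0 x0) \<le> ennreal (D2 powr \<theta> * ln (1 / r) powr (min p q * (1 / q - 1)))"
        using low up t0 by blast+
    qed simp
  qed (use D1 D2 in auto)
qed

theorem theorem1p3:
  fixes \<alpha> p q :: real
  assumes "0 < \<alpha>" "\<alpha> < 1" "1 \<le> p" "1 < q"
  shows
    "(real CARD('n::finite) / p + 2 * \<alpha> / q - 2 * \<alpha> > 0 \<longrightarrow>
       (\<exists>c1 > 0. \<exists>c2 > 0. \<forall>t0 > 0. \<forall>x0 :: real ^ 'n. \<exists>\<rho> > 0. \<forall>r. 0 < r \<and> r < \<rho> \<longrightarrow>
          ennreal (c1 * r powr (min p q * (real CARD('n) / p + 2 * \<alpha> / q - 2 * \<alpha>)))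
            \<le> capacity \<alpha> p q (parabolic_ball \<alpha> r t0 x0) \<and>
          capacity \<alpha> p q (parabolic_ball \<alpha> r t0 x0)
            \<le> ennreal (c2 * r powr (min p q * (real CARD('n) / p + 2 * \<alpha> / q - 2 * \<alpha>))))) \<and>
     (real CARD('n) / p + 2 * \<alpha> / q - 2 * \<alpha> = 0 \<longrightarrow>
       (\<exists>c1 > 0. \<exists>c2 > 0. \<forall>t0 > 0. \<forall>x0 :: real ^ 'n. \<exists>\<rho> > 0. \<forall>r. 0 < r \<and> r < \<rho> \<longrightarrow>
          ennreal (c1 * ln (1 / r) powr (min p q * (1 / q - 1)))
            \<le> capacity \<alpha> p q (parabolic_ball \<alpha> r t0 x0) \<and>
          capacity \<alpha> p q (parabolic_ball \<alpha> r t0 x0)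
            \<le> ennreal (c2 * ln (1 / r) powr (min p q * (1 / q - 1)))))"
  using capacity_parabolic_ball_power[OF assms, where 'n='n]
    capacity_parabolic_ball_log[OF assms, where 'n='n]
  by blast

end
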